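(* Let $\Phi:(\mathbb{R}^m,0)\to(\mathbb{R}^n,0)$ be a degenerate rounding. Then there exist an integer $k<m$, a projection (surjective linear map) $\pi:\mathbb{R}^m\to\mathbb{R}^k$ and a nondegenerate fractional quadratic rounding $\Psi:(\mathbb{R}^k,0)\to(\mathbb{R}^n,0)$ such that $\Psi\circ\pi$ is equivalent to $\Phi$.
   Context: $\mathbb{R}^n$ carries the Euclidean inner product $\langle\cdot,\cdot\rangle$. A circle in a Euclidean space means a round Euclidean circle, or a straight line, or a point. A vector line is a line passing through the origin. A rounding is a germ at $0$ of a real analytic map $\Phi:(\mathbb{R}^m,0)\to(\mathbb{R}^n,0)$ (so $\Phi(0)=0$) that takes every germ at $0$ of a vector line to a germ of a circle, i.e. the image of each such germ is contained in a circle. The rank of a rounding is the rank of its first differential at $0$; standing assumption: every rounding has rank at least $2$. Two roundings $\Phi_1,\Phi_2$ are equivalent if for every germ at $0$ of a vector line $l$ the germs $\Phi_1(l)$ and $\Phi_2(l)$ belong to the same circle. A fractional quadratic rounding is a rounding of the form $x\mapsto P(x)/Q(x)$, where $P$ is a map given in coordinates by (not necessarily homogeneous) quadratic polynomials and $Q$ is a (not necessarily homogeneous) quadratic polynomial. For a rounding $\Phi$ with 2-jet $A+B$ at $0$ ($A$ linear, $B$ homogeneous quadratic), the polynomials $\langle A,B\rangle:x\mapsto\langle A(x),B(x)\rangle$ and $\langle B,B\rangle:x\mapsto\langle B(x),B(x)\rangle$ are divisible by $\langle A,A\rangle:x\mapsto\langle A(x),A(x)\rangle$; put $p=\langle A,B\rangle/\langle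 A,A\rangle$ (a linear form) and $q=\langle B,B\rangle/\langle A,A\rangle$ (a quadratic form). The rounding $\Phi$ is degenerate if there is a point $x_0$ in its source space, $x_0\neq 0$, such that $A(x_0)=0$ and $q(x_0)=p(x_0)^2$; otherwise it is nondegenerate. *)

theory Defs
  imports "HOL-Analysis.Analysis"
begin

text \<open>
  The source dimension of a map has to be quantified inside the statement, so source spaces are the
  library's \<open>Euclidean_space m\<close>, whose points are the functions \<open>x :: nat \<Rightarrow> real\<close> with \<open>x i = 0\<close>
  for \<open>i \<ge> m\<close>. Target spaces keep their Euclidean type. A germ at the origin is given by a
  total function, and every notion below depends only on its values on a neighbourhood of the
  origin in \<open>Euclidean_space m\<close>.
\<close>

abbreviation Rn :: "nat \<Rightarrow> (nat \<Rightarrow> real) set"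
  where "Rn m \<equiv> topspace (Euclidean_space m)"

abbreviation origin :: "nat \<Rightarrow> real"
  where "origin \<equiv> (\<lambda>_. 0)"

abbreviation near_origin :: "nat \<Rightarrow> (nat \<Rightarrow> real) filter"
  where "near_origin m \<equiv> nhdsin (Euclidean_space m) origin"

definition linear_map :: "nat \<Rightarrow> nat \<Rightarrow> ((nat \<Rightarrow> real) \<Rightarrow> (nat \<Rightarrow> real)) \<Rightarrow> bool"
  where "linear_map m k L \<longleftrightarrow> L ` Rn m \<subseteq> Rn k \<and>
    (\<forall>x\<in>Rn m. \<forall>y\<in>Rn m. \<forall>a b. L (\<lambda>i. a * x i + b * y i) = (\<lambda>i. a * L x i + b * L y i))"

definition multi_indices :: "nat \<Rightarrow> (nat \<Rightarrow> nat) set"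
  where "multi_indices m = {\<alpha>. \<forall>i\<ge>m. \<alpha> i = 0}"

definition monomial :: "nat \<Rightarrow> (nat \<Rightarrow> nat) \<Rightarrow> (nat \<Rightarrow> real) \<Rightarrow> real"
  where "monomial m \<alpha> x = (\<Prod>i<m. x i ^ \<alpha> i)"

definition hom_poly :: "nat \<Rightarrow> nat \<Rightarrow> ((nat \<Rightarrow> nat) \<Rightarrow> 'b::real_vector) \<Rightarrow> (nat \<Rightarrow> real) \<Rightarrow> 'b"
  where "hom_poly m d c x =
    (\<Sum>\<alpha> | \<alpha> \<in> multi_indices m \<and> (\<Sum>i<m. \<alpha> i) = d. monomial m \<alpha> x *\<^sub>R c \<alpha>)"

text \<open>Real (\<open>'b = real\<close>) or coordinatewise vector-valued polynomials of degree at most 2.\<close>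

definition quadratic_map :: "nat \<Rightarrow> ((nat \<Rightarrow> real) \<Rightarrow> 'b::real_vector) \<Rightarrow> bool"
  where "quadratic_map m f \<longleftrightarrow> (\<exists>c. \<forall>x\<in>Rn m. f x = (\<Sum>d\<le>2. hom_poly m d c x))"

definition power_series_at_origin ::
    "nat \<Rightarrow> ((nat \<Rightarrow> real) \<Rightarrow> 'b::euclidean_space) \<Rightarrow> ((nat \<Rightarrow> nat) \<Rightarrow> 'b) \<Rightarrow> bool"
  where "power_series_at_origin m \<Phi> c \<longleftrightarrow>
    (\<forall>\<^sub>F x in near_origin m. ((\<lambda>\<alpha>. monomial m \<alpha> x *\<^sub>R c \<alpha>) has_sum \<Phi> x) (multi_indices m))"

definition analytic_germ :: "nat \<Rightarrow> ((nat \<Rightarrow> real) \<Rightarrow> 'b::euclidean_space) \<Rightarrow> bool"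
  where "analytic_germ m \<Phi> \<longleftrightarrow> (\<exists>c. power_series_at_origin m \<Phi> c)"

text \<open>
  The homogeneous part of degree \<open>d\<close> of the Taylor expansion at the origin; it is unique because
  the power series of an analytic germ is.
\<close>

definition taylor_part ::
    "nat \<Rightarrow> nat \<Rightarrow> ((nat \<Rightarrow> real) \<Rightarrow> 'b::euclidean_space) \<Rightarrow> (nat \<Rightarrow> real) \<Rightarrow> 'b"
  where "taylor_part m d \<Phi> = (THE f. \<exists>c. power_series_at_origin m \<Phi> c \<and> f = hom_poly m d c)"

definition circle :: "'b::euclidean_space set \<Rightarrow> bool"
  where "circle C \<longleftrightarrow>
    (\<exists>c r L. r > 0 \<and> affine L \<and> aff_dim L = 2 \<and> c \<in> L \<and> C = sphere c r \<inter> L) \<or>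
    (affine C \<and> aff_dim C = 1) \<or>
    (\<exists>a. C = {a})"

definition rounding :: "nat \<Rightarrow> ((nat \<Rightarrow> real) \<Rightarrow> 'b::euclidean_space) \<Rightarrow> bool"
  where "rounding m \<Phi> \<longleftrightarrow>
    analytic_germ m \<Phi> \<and> \<Phi> origin = 0 \<and>
    (\<forall>v\<in>Rn m - {origin}. \<exists>C. circle C \<and> (\<forall>\<^sub>F t in nhds 0. \<Phi> (\<lambda>i. t * v i) \<in> C)) \<and>
    dim (taylor_part m 1 \<Phi> ` Rn m) \<ge> 2"

definition equivalent_roundings ::
    "nat \<Rightarrow> ((nat \<Rightarrow> real) \<Rightarrow> 'b::euclidean_space) \<Rightarrow> ((nat \<Rightarrow> real) \<Rightarrow> 'b) \<Rightarrow> bool"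
  where "equivalent_roundings m \<Phi>\<^sub>1 \<Phi>\<^sub>2 \<longleftrightarrow>
    rounding m \<Phi>\<^sub>1 \<and> rounding m \<Phi>\<^sub>2 \<and>
    (\<forall>v\<in>Rn m - {origin}. \<exists>C. circle C \<and>
      (\<forall>\<^sub>F t in nhds 0. \<Phi>\<^sub>1 (\<lambda>i. t * v i) \<in> C \<and> \<Phi>\<^sub>2 (\<lambda>i. t * v i) \<in> C))"

text \<open>The denominator must not vanish at the origin, where the fraction has to be defined.\<close>

definition fractional_quadratic_rounding ::
    "nat \<Rightarrow> ((nat \<Rightarrow> real) \<Rightarrow> 'b::euclidean_space) \<Rightarrow> bool"
  where "fractional_quadratic_rounding m \<Phi> \<longleftrightarrow>
    rounding m \<Phi> \<and>
    (\<exists>P Q. quadratic_map m P \<and> quadratic_map m Q \<and> Q origin \<noteq> (0::real) \<and>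
      (\<forall>\<^sub>F x in near_origin m. \<Phi> x = P x /\<^sub>R Q x))"

text \<open>
  \<open>h\<close> is a homogeneous polynomial of degree \<open>d\<close> with \<open>f = h g\<close>. Such an \<open>h\<close> is unique
  when \<open>g\<close> is a nonzero polynomial.
\<close>

definition quotient_form ::
    "nat \<Rightarrow> nat \<Rightarrow> ((nat \<Rightarrow> real) \<Rightarrow> real) \<Rightarrow> ((nat \<Rightarrow> real) \<Rightarrow> real) \<Rightarrow> ((nat \<Rightarrow> real) \<Rightarrow> real) \<Rightarrow> bool"
  where "quotient_form m d f g h \<longleftrightarrow> (\<exists>c. h = hom_poly m d c) \<and> (\<forall>x\<in>Rn m. f x = h x * g x)"

text \<open>
  Below, \<open>p = \<langle>A,B\<rangle> / \<langle>A,A\<rangle>\<close> and \<open>q = \<langle>B,B\<rangle> / \<langle>A,A\<rangle>\<close>, where \<open>A + B\<close> is the 2-jet of \<open>\<Phi>\<close>. For a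
  rounding both divisions are exact, so \<open>p\<close> and \<open>q\<close> exist and are unique.
\<close>

definition degenerate_rounding :: "nat \<Rightarrow> ((nat \<Rightarrow> real) \<Rightarrow> 'b::euclidean_space) \<Rightarrow> bool"
  where "degenerate_rounding m \<Phi> \<longleftrightarrow>
    rounding m \<Phi> \<and>
    (let A = taylor_part m 1 \<Phi>; B = taylor_part m 2 \<Phi> in
      \<exists>p q. quotient_form m 1 (\<lambda>x. A x \<bullet> B x) (\<lambda>x. A x \<bullet> A x) p \<and>
            quotient_form m 2 (\<lambda>x. B x \<bullet> B x) (\<lambda>x. A x \<bullet> A x) q \<and>
            (\<exists>x\<^sub>0\<in>Rn m - {origin}. A x\<^sub>0 = 0 \<and> q x\<^sub>0 = (p x\<^sub>0)\<^sup>2))"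

definition nondegenerate_rounding :: "nat \<Rightarrow> ((nat \<Rightarrow> real) \<Rightarrow> 'b::euclidean_space) \<Rightarrow> bool"
  where "nondegenerate_rounding m \<Phi> \<longleftrightarrow> rounding m \<Phi> \<and> \<not> degenerate_rounding m \<Phi>"

end

theory Submission
  imports Defs
begin

text \<open>
  Replacing the 2-jet \<open>A + B\<close> by \<open>A + B'\<close> with \<open>B' = B - p A\<close> and setting \<open>q' = q - p\<^sup>2\<close> gives
  \<open>\<langle>A, B'\<rangle> = 0\<close>, \<open>\<langle>B', B'\<rangle> = q' \<langle>A, A\<rangle>\<close> and \<open>q' \<ge> 0\<close>. The circle through the origin with 2-jet
  \<open>t A v + t\<^sup>2 B v\<close> is parametrised by \<open>F (t v)\<close>, where \<open>F = (A + B') / (1 + q')\<close>, so that \<open>F\<close> is equivalent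
  to \<open>\<Phi>\<close>; where \<open>A v = 0\<close>, the map \<open>F\<close> vanishes on the whole line, so any circle containing the image
  under \<open>\<Phi>\<close> will do. As \<open>q'\<close> is positive semidefinite, the vectors with \<open>A z = 0\<close> and \<open>q' z = 0\<close> form a
  subspace \<open>K\<close>, and \<open>K\<close> is nonzero exactly when \<open>\<Phi>\<close> is degenerate. Translation by \<open>z \<in> K\<close> preserves
  \<open>A\<close> and \<open>q'\<close>, hence the length of \<open>B'\<close>; a polynomial that is bounded along a line is constant
  on it, so \<open>B'\<close> is preserved too. Thus \<open>F\<close> factors through the quotient by \<open>K\<close>, where the induced
  fractional quadratic map is nondegenerate.
\<close>

subsection \<open>Homogeneous polynomial maps\<close>

text \<open>The equality is one of total functions. As \<open>hom_poly\<close> reads only the first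
  \<open>m\<close> coordinates, two such maps of equal degree that agree on \<open>Rn m\<close> are
  equal.\<close>

definition homogeneous :: "nat \<Rightarrow> nat \<Rightarrow> ((nat \<Rightarrow> real) \<Rightarrow> 'b::real_vector) \<Rightarrow> bool"
  where "homogeneous m d f \<longleftrightarrow> (\<exists>c. f = hom_poly m d c)"

abbreviation degree_indices :: "nat \<Rightarrow> nat \<Rightarrow> (nat \<Rightarrow> nat) set"
  where "degree_indices m d \<equiv> {\<alpha>. \<alpha> \<in> multi_indices m \<and> (\<Sum>i<m. \<alpha> i) = d}"

lemma finite_degree_indices: "finite (degree_indices m d)"
proof -
  have "finite {\<alpha>::nat \<Rightarrow> nat. \<forall>i. (i \<in> {..<m} \<longrightarrow> \<alpha> i \<in> {..d}) \<and> (i \<notin> {..<m} \<longrightarrow> \<alpha> i = 0)}"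
    by (rule finite_set_of_finite_funs) auto
  moreover have "\<alpha> i \<le> d" if "(\<Sum>i<m. \<alpha> i) = d" "i < m" for \<alpha> :: "nat \<Rightarrow> nat" and i
    using member_le_sum[of i "{..<m}" \<alpha>] that by auto
  ultimately show ?thesis
    by (elim finite_subset[rotated]) (auto simp: multi_indices_def)
qed

lemma homogeneous_hom_poly: "homogeneous m d (hom_poly m d c)"
  by (auto simp: homogeneous_def)

lemma homogeneous_zero: "homogeneous m d (\<lambda>x. 0)"
  unfolding homogeneous_def by (rule exI[of _ "\<lambda>_. 0"]) (auto simp: hom_poly_def)

lemma homogeneous_add:
  assumes "homogeneous m d f" "homogeneous m d g"
  shows "homogeneous m d (\<lambda>x. f x + g x)"
proof -
  obtain a b where "f = hom_poly m d a" "g = hom_poly m d b"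
    using assms by (auto simp: homogeneous_def)
  then have "(\<lambda>x. f x + g x) = hom_poly m d (\<lambda>\<alpha>. a \<alpha> + b \<alpha>)"
    by (simp add: hom_poly_def fun_eq_iff scaleR_add_right sum.distrib)
  then show ?thesis by (auto simp: homogeneous_def)
qed

lemma homogeneous_sum:
  assumes "\<And>i. i \<in> I \<Longrightarrow> homogeneous m d (f i)"
  shows "homogeneous m d (\<lambda>x. \<Sum>i\<in>I. f i x)"
  using assms
  by (induction I rule: infinite_finite_induct) (auto intro: homogeneous_zero homogeneous_add)

lemma homogeneous_scaleR:
  assumes "homogeneous m d f"
  shows "homogeneous m d (\<lambda>x. a *\<^sub>R f x)"
proof -
  obtain c where "f = hom_poly m d c"
    using assms by (auto simp: homogeneous_def)
  then have "(\<lambda>x. a *\<^sub>R f x) = hom_poly m d (\<lambda>\<alpha>. a *\<^sub>R c \<alpha>)"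
    by (simp add: hom_poly_def fun_eq_iff scaleR_sum_right algebra_simps)
  then show ?thesis by (auto simp: homogeneous_def)
qed

lemma homogeneous_diff:
  assumes "homogeneous m d f" "homogeneous m d g"
  shows "homogeneous m d (\<lambda>x. f x - g x)"
  using homogeneous_add[OF assms(1) homogeneous_scaleR[OF assms(2), of "-1"]] by simp

lemma homogeneous_monomial:
  assumes "\<alpha> \<in> degree_indices m d"
  shows "homogeneous m d (\<lambda>x. monomial m \<alpha> x *\<^sub>R v)"
proof -
  have "monomial m \<alpha> x *\<^sub>R v = hom_poly m d (\<lambda>\<beta>. if \<beta> = \<alpha> then v else 0) x" for x
  proof -
    have "hom_poly m d (\<lambda>\<beta>. if \<beta> = \<alpha> then v else 0) x
        = (\<Sum>\<beta>\<in>degree_indices m d. if \<beta> = \<alpha> then monomial m \<alpha> x *\<^sub>R v else 0)"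
      unfolding hom_poly_def by (rule sum.cong) auto
    also have "\<dots> = monomial m \<alpha> x *\<^sub>R v"
      using assms by (simp add: sum.delta[OF finite_degree_indices])
    finally show ?thesis by simp
  qed
  then show ?thesis by (auto simp: homogeneous_def fun_eq_iff)
qed

lemma monomial_add: "monomial m (\<lambda>i. \<alpha> i + \<beta> i) x = monomial m \<alpha> x * monomial m \<beta> x"
  by (simp add: monomial_def power_add prod.distrib)

text \<open>Different pairs \<open>\<alpha>\<close>, \<open>\<beta>\<close> may yield the same
  exponent; closure under sums of monomials avoids collecting coefficients.\<close>

lemma homogeneous_mult:
  assumes "homogeneous m d f" "homogeneous m e g"
  shows "homogeneous m (d + e) (\<lambda>x. f x *\<^sub>R g x)"
proof -
  obtain a b where f: "f = hom_poly m d a" and g: "g = hom_poly m e b"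
    using assms by (auto simp: homogeneous_def)
  have eq: "f x *\<^sub>R g x = (\<Sum>\<alpha>\<in>degree_indices m d. \<Sum>\<beta>\<in>degree_indices m e.
      monomial m (\<lambda>i. \<alpha> i + \<beta> i) x *\<^sub>R (a \<alpha> *\<^sub>R b \<beta>))" for x
  proof -
    have "f x *\<^sub>R g x = (\<Sum>\<alpha>\<in>degree_indices m d. \<Sum>\<beta>\<in>degree_indices m e.
        (monomial m \<alpha> x * a \<alpha>) *\<^sub>R (monomial m \<beta> x *\<^sub>R b \<beta>))"
      unfolding f g hom_poly_def
      by (simp only: scaleR_sum_left) (simp only: scaleR_sum_right real_scaleR_def)
    then show ?thesis
      by (simp add: monomial_add mult_ac)
  qed
  show ?thesis
    unfolding eq
  proof (intro homogeneous_sum homogeneous_monomial)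
    fix \<alpha> \<beta> assume "\<alpha> \<in> degree_indices m d" "\<beta> \<in> degree_indices m e"
    then show "(\<lambda>i. \<alpha> i + \<beta> i) \<in> degree_indices m (d + e)"
      by (auto simp: multi_indices_def sum.distrib)
  qed
qed

lemma homogeneous_const: "homogeneous m 0 (\<lambda>x. v)"
  using homogeneous_monomial[of "\<lambda>_. 0" m 0 v] by (simp add: monomial_def multi_indices_def)

lemma homogeneous_coordinate:
  assumes "i < m"
  shows "homogeneous m 1 (\<lambda>x. x i *\<^sub>R v)"
proof -
  have "monomial m (\<lambda>j. if j = i then 1 else 0) x = x i" for x
  proof -
    have "monomial m (\<lambda>j. if j = i then 1 else 0) x = (\<Prod>j<m. if j = i then x j else 1)"
      unfolding monomial_def by (rule prod.cong) auto
    then show ?thesis using assms by (simp add: prod.delta)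
  qed
  then show ?thesis
    using homogeneous_monomial[of "\<lambda>j. if j = i then 1 else 0" m 1 v] assms
    by (simp add: multi_indices_def)
qed

lemma homogeneous_prod_power:
  fixes s :: "nat \<Rightarrow> (nat \<Rightarrow> real) \<Rightarrow> real"
  assumes "\<And>i. i \<in> I \<Longrightarrow> homogeneous k 1 (s i)"
  shows "homogeneous k (\<Sum>i\<in>I. \<alpha> i) (\<lambda>x. \<Prod>i\<in>I. s i x ^ \<alpha> i)"
proof -
  have pow: "homogeneous k n (\<lambda>x. s i x ^ n)" if "i \<in> I" for i n
  proof (induction n)
    case 0 then show ?case by (simp add: homogeneous_const)
  next
    case (Suc n) then show ?case using homogeneous_mult[OF assms[OF that] Suc] by simp
  qed
  show ?thesis
    using pow
  proof (induction I rule: infinite_finite_induct)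
    case (insert i I)
    have "homogeneous k (\<alpha> i + (\<Sum>i\<in>I. \<alpha> i)) (\<lambda>x. (s i x ^ \<alpha> i) *\<^sub>R (\<Prod>i\<in>I. s i x ^ \<alpha> i))"
      by (rule homogeneous_mult) (use insert in auto)
    then show ?case using insert by simp
  qed (auto intro: homogeneous_const)
qed

lemma homogeneous_comp:
  assumes "homogeneous m d f" "\<And>i. i < m \<Longrightarrow> homogeneous k 1 (\<lambda>x. \<sigma> x i)"
  shows "homogeneous k d (\<lambda>x. f (\<sigma> x))"
proof -
  obtain c where f: "f = hom_poly m d c"
    using assms by (auto simp: homogeneous_def)
  show ?thesis
    unfolding f hom_poly_def
  proof (rule homogeneous_sum)
    fix \<alpha> assume \<alpha>: "\<alpha> \<in> degree_indices m d"
    have "homogeneous k ((\<Sum>i<m. \<alpha> i) + 0) (\<lambda>x. (\<Prod>i<m. \<sigma> x i ^ \<alpha> i) *\<^sub>R c \<alpha>)"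
      by (intro homogeneous_mult homogeneous_const homogeneous_prod_power) (use assms in auto)
    then show "homogeneous k d (\<lambda>x. monomial m \<alpha> (\<sigma> x) *\<^sub>R c \<alpha>)"
      using \<alpha> by (simp add: monomial_def)
  qed
qed

lemma hom_poly_scale: "hom_poly m d c (\<lambda>i. t * x i) = t ^ d *\<^sub>R hom_poly m d c x"
proof -
  have "monomial m \<alpha> (\<lambda>i. t * x i) = t ^ (\<Sum>i<m. \<alpha> i) * monomial m \<alpha> x" for \<alpha>
    by (simp add: monomial_def power_mult_distrib prod.distrib power_sum)
  then show ?thesis
    by (simp add: hom_poly_def scaleR_sum_right)
qed

lemma homogeneous_scale: "homogeneous m d f \<Longrightarrow> f (\<lambda>i. t * x i) = t ^ d *\<^sub>R f x"
  by (auto simp: homogeneous_def hom_poly_scale)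

lemma homogeneous_cong:
  assumes "homogeneous m d f" "\<And>i. i < m \<Longrightarrow> x i = y i"
  shows "f x = f y"
  using assms by (auto simp: homogeneous_def hom_poly_def monomial_def intro!: sum.cong)

lemma homogeneous_eqI:
  assumes "homogeneous m d f" "homogeneous m d g" "\<And>x. x \<in> Rn m \<Longrightarrow> f x = g x"
  shows "f = g"
proof
  fix x
  \<comment> \<open>Cutting \<open>x\<close> off at index \<open>m\<close> lands in
    \<open>Rn m\<close> and changes neither value.\<close>
  let ?y = "\<lambda>i. if i < m then x i else (0::real)"
  have "?y \<in> Rn m" by (simp add: topspace_Euclidean_space)
  then show "f x = g x"
    using assms(3) homogeneous_cong[OF assms(1), of x ?y] homogeneous_cong[OF assms(2), of x ?y] by simp
qed

section \<open>Monomials of degree one and two\<close>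

lemma degree_indices_Suc:
  assumes "\<alpha> \<in> degree_indices m (Suc d)"
  obtains i \<beta> where "i < m" "\<beta> \<in> degree_indices m d" "\<And>x. monomial m \<alpha> x = x i * monomial m \<beta> x"
proof -
  have "(\<Sum>i<m. \<alpha> i) \<noteq> 0" using assms by auto
  then obtain i where i: "i < m" "\<alpha> i \<noteq> 0" by (auto simp: sum_eq_0_iff)
  define \<beta> where "\<beta> = \<alpha>(i := \<alpha> i - 1)"
  have mi: "\<beta> \<in> multi_indices m" using assms i by (auto simp: multi_indices_def \<beta>_def)
  have "(\<Sum>j<m. \<alpha> j) = \<alpha> i + (\<Sum>j\<in>{..<m}-{i}. \<alpha> j)"
    using i by (intro sum.remove) auto
  moreover have "(\<Sum>j<m. \<beta> j) = \<beta> i + (\<Sum>j\<in>{..<m}-{i}. \<beta> j)"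
    using i by (intro sum.remove) auto
  moreover have "(\<Sum>j\<in>{..<m}-{i}. \<beta> j) = (\<Sum>j\<in>{..<m}-{i}. \<alpha> j)"
    by (rule sum.cong) (auto simp: \<beta>_def)
  ultimately have deg: "(\<Sum>j<m. \<beta> j) = d" using i assms by (auto simp: \<beta>_def)
  have "monomial m \<alpha> x = x i * monomial m \<beta> x" for x
  proof -
    have "monomial m \<alpha> x = x i ^ \<alpha> i * (\<Prod>j\<in>{..<m}-{i}. x j ^ \<alpha> j)"
      unfolding monomial_def using i by (intro prod.remove) auto
    moreover have "monomial m \<beta> x = x i ^ \<beta> i * (\<Prod>j\<in>{..<m}-{i}. x j ^ \<beta> j)"
      unfolding monomial_def using i by (intro prod.remove) auto
    moreover have "(\<Prod>j\<in>{..<m}-{i}. x j ^ \<beta> j) = (\<Prod>j\<in>{..<m}-{i}. x j ^ \<alpha> j)"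
      by (rule prod.cong) (auto simp: \<beta>_def)
    moreover have "x i ^ \<alpha> i = x i * x i ^ \<beta> i"
      using i by (cases "\<alpha> i") (auto simp: \<beta>_def)
    ultimately show ?thesis by simp
  qed
  with i mi deg show ?thesis by (intro that[of i \<beta>]) auto
qed

lemma monomial_degree_0:
  assumes "\<alpha> \<in> degree_indices m 0"
  shows "monomial m \<alpha> x = 1"
  using assms by (auto simp: monomial_def)

lemma homogeneous_1_linear:
  assumes "homogeneous m 1 f"
  shows "f (\<lambda>i. a * x i + b * y i) = a *\<^sub>R f x + b *\<^sub>R f y"
proof -
  obtain c where f: "f = hom_poly m 1 c"
    using assms by (auto simp: homogeneous_def)
  have "monomial m \<alpha> (\<lambda>i. a * x i + b * y i) = a * monomial m \<alpha> x + b * monomial m \<alpha> y"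
    if \<alpha>: "\<alpha> \<in> degree_indices m 1" for \<alpha>
  proof -
    have "\<alpha> \<in> degree_indices m (Suc 0)" using \<alpha> by simp
    from degree_indices_Suc[OF this]
    obtain i \<beta> where "\<beta> \<in> degree_indices m 0" "\<And>x. monomial m \<alpha> x = x i * monomial m \<beta> x"
      by metis
    then show ?thesis by (simp add: monomial_degree_0)
  qed
  then have "f (\<lambda>i. a * x i + b * y i)
      = (\<Sum>\<alpha>\<in>degree_indices m 1. (a * monomial m \<alpha> x + b * monomial m \<alpha> y) *\<^sub>R c \<alpha>)"
    unfolding f hom_poly_def by (intro sum.cong) auto
  also have "\<dots> = a *\<^sub>R f x + b *\<^sub>R f y"
    by (simp add: f hom_poly_def scaleR_sum_right scaleR_add_left sum.distrib)
  finally show ?thesis .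
qed

text \<open>\<open>g\<close> is twice the polar form of \<open>f\<close> at \<open>x\<close> and
  \<open>y\<close>; what matters later is that it does not depend on \<open>t\<close>.\<close>

lemma homogeneous_2_expand:
  assumes "homogeneous m 2 f"
  obtains g where "\<And>t. f (\<lambda>i. x i + t * y i) = f x + t *\<^sub>R g + t\<^sup>2 *\<^sub>R f y"
proof -
  obtain c where f: "f = hom_poly m 2 c"
    using assms by (auto simp: homogeneous_def)
  have "\<exists>i j. \<forall>x. monomial m \<alpha> x = x i * x j" if \<alpha>: "\<alpha> \<in> degree_indices m 2" for \<alpha>
  proof -
    have "\<alpha> \<in> degree_indices m (Suc (Suc 0))" using \<alpha> by (simp add: numeral_2_eq_2)
    from degree_indices_Suc[OF this]
    obtain i \<beta> where \<beta>: "\<beta> \<in> degree_indices m (Suc 0)" "\<And>x. monomial m \<alpha> x = x i * monomial m \<beta> x"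
      by metis
    from degree_indices_Suc[OF \<beta>(1)]
    obtain j \<gamma> where "\<gamma> \<in> degree_indices m 0" "\<And>x. monomial m \<beta> x = x j * monomial m \<gamma> x"
      by metis
    then show ?thesis using \<beta>(2) by (auto simp: monomial_degree_0)
  qed
  then obtain i j where ij: "\<And>\<alpha> x. \<alpha> \<in> degree_indices m 2 \<Longrightarrow> monomial m \<alpha> x = x (i \<alpha>) * x (j \<alpha>)"
    by metis
  have f': "f x = (\<Sum>\<alpha>\<in>degree_indices m 2. (x (i \<alpha>) * x (j \<alpha>)) *\<^sub>R c \<alpha>)" for x
    unfolding f hom_poly_def by (intro sum.cong) (auto simp: ij)
  define g where "g = (\<Sum>\<alpha>\<in>degree_indices m 2. (x (i \<alpha>) * y (j \<alpha>) + x (j \<alpha>) * y (i \<alpha>)) *\<^sub>R c \<alpha>)"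
  have "f (\<lambda>i. x i + t * y i) = f x + t *\<^sub>R g + t\<^sup>2 *\<^sub>R f y" for t
    unfolding f' g_def
    by (simp add: scaleR_sum_right flip: sum.distrib scaleR_add_left)
       (auto intro!: sum.cong arg_cong2[where f=scaleR] simp: algebra_simps power2_eq_square)
  then show ?thesis by (rule that)
qed

lemma homogeneous_tendsto:
  fixes f :: "(nat \<Rightarrow> real) \<Rightarrow> 'b::real_normed_vector"
  assumes "homogeneous m d f"
  shows "((\<lambda>t. f (\<lambda>i. x i + t * y i)) \<longlongrightarrow> f x) (at 0)"
proof -
  obtain c where f: "f = hom_poly m d c"
    using assms by (auto simp: homogeneous_def)
  have "((\<lambda>t. f (\<lambda>i. x i + t * y i)) \<longlongrightarrow> f (\<lambda>i. x i + 0 * y i)) (at 0)"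
    unfolding f hom_poly_def monomial_def by (intro tendsto_intros)
  then show ?thesis by simp
qed

subsection \<open>Power series\<close>

lemma eventually_near_origin_line:
  assumes "eventually P (near_origin m)" "v \<in> Rn m"
  shows "\<forall>\<^sub>F t in nhds 0. P (\<lambda>i. t * v i)"
proof -
  have "origin \<in> Rn m" by (simp add: topspace_Euclidean_space)
  then obtain S where S: "openin (Euclidean_space m) S" "origin \<in> S" "\<And>x. x \<in> S \<Longrightarrow> P x"
    using assms(1) unfolding eventually_nhdsin by auto
  have "continuous_map euclideanreal (Euclidean_space m) (\<lambda>t i. t * v i)"
    using assms(2) unfolding Euclidean_space_def
    by (auto simp: continuous_map_in_subtopology continuous_map_componentwise_UNIV
             intro!: continuous_intros)
  from openin_continuous_map_preimage[OF this S(1)]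
  have "open {t. (\<lambda>i. t * v i) \<in> S}" by simp
  then show ?thesis
    unfolding eventually_nhds using S by (intro exI[of _ "{t. (\<lambda>i. t * v i) \<in> S}"]) auto
qed

lemma eventually_near_origin_box:
  assumes "r > 0"
  shows "\<forall>\<^sub>F x in near_origin m. x \<in> Rn m \<and> (\<forall>i<m. \<bar>x i\<bar> < r)"
proof -
  have "{x::nat \<Rightarrow> real. \<forall>i<m. \<bar>x i\<bar> < r} = (\<Inter>i\<in>{..<m}. {x. \<bar>x i\<bar> < r})" by auto
  moreover have "open (\<Inter>i\<in>{..<m}. {x::nat \<Rightarrow> real. \<bar>x i\<bar> < r})"
    by (intro open_INT ballI open_Collect_less continuous_intros) auto
  ultimately have "openin (powertop_real UNIV) {x. \<forall>i<m. \<bar>x i\<bar> < r}"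
    by (simp add: euclidean_product_topology)
  then have "openin (Euclidean_space m) (Rn m \<inter> {x. \<forall>i<m. \<bar>x i\<bar> < r})"
    unfolding Euclidean_space_def by (auto simp: openin_subtopology)
  then show ?thesis
    unfolding eventually_nhdsin using assms
    by (intro disjI2 exI[of _ "Rn m \<inter> {x. \<forall>i<m. \<bar>x i\<bar> < r}"])
       (auto simp: topspace_Euclidean_space)
qed

text \<open>An unordered sum may be regrouped by degree, and on a line the block of degree
  \<open>d\<close> is a single power of \<open>t\<close> times a vector. This reduces questions on
  several variables to series in \<open>t\<close>.\<close>

lemma power_series_along_line:
  fixes \<Phi> :: "(nat \<Rightarrow> real) \<Rightarrow> 'b::euclidean_space"
  assumes "power_series_at_origin m \<Phi> c" "v \<in> Rn m"
  shows "\<forall>\<^sub>F t in nhds 0. (\<lambda>d. t ^ d *\<^sub>R hom_poly m d c v) sums \<Phi> (\<lambda>i. t * v i)"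
proof -
  have "(\<lambda>d. t ^ d *\<^sub>R hom_poly m d c v) sums s"
    if "((\<lambda>\<alpha>. monomial m \<alpha> (\<lambda>i. t * v i) *\<^sub>R c \<alpha>) has_sum s) (multi_indices m)" for t s
  proof -
    let ?f = "\<lambda>\<alpha>. monomial m \<alpha> (\<lambda>i. t * v i) *\<^sub>R c \<alpha>"
    \<comment> \<open>Each multi-index is paired with its degree, so that the blocks are the finite
      sets \<open>degree_indices m d\<close>.\<close>
    have "((\<lambda>p. ?f (snd p)) has_sum s) (Sigma UNIV (degree_indices m)) \<longleftrightarrow> (?f has_sum s) (multi_indices m)"
      by (rule has_sum_reindex_bij_witness[of _ "\<lambda>\<alpha>. (\<Sum>i<m. \<alpha> i, \<alpha>)" snd]) auto
    then have "((\<lambda>p. ?f (snd p)) has_sum s) (Sigma UNIV (degree_indices m))"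
      using that by simp
    then have "((\<lambda>d. hom_poly m d c (\<lambda>i. t * v i)) has_sum s) UNIV"
      by (rule has_sum_SigmaD) (simp add: hom_poly_def has_sum_finite finite_degree_indices)
    then show ?thesis
      using has_sum_imp_sums by (simp add: hom_poly_scale)
  qed
  then show ?thesis
    using eventually_near_origin_line[OF assms(1)[unfolded power_series_at_origin_def] assms(2)]
    by (auto elim: eventually_mono)
qed

text \<open>Dropping \<open>n\<close> terms and dividing by \<open>t ^ n\<close> leaves a power
  series with constant term \<open>g n\<close>, whose sum is continuous at 0. The limit is taken in
  each coordinate, where the series is scalar.\<close>

lemma power_series_remainder_tendsto:
  fixes g :: "nat \<Rightarrow> 'b::euclidean_space"
  assumes "\<forall>\<^sub>F t in nhds 0. (\<lambda>d. t ^ d *\<^sub>R g d) sums \<phi> (t::real)"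
  shows "((\<lambda>t. inverse (t ^ n) *\<^sub>R (\<phi> t - (\<Sum>d<n. t ^ d *\<^sub>R g d))) \<longlongrightarrow> g n) (at 0)"
proof -
  obtain \<delta> where \<delta>: "\<delta> > 0" "\<And>t. \<bar>t\<bar> < \<delta> \<Longrightarrow> (\<lambda>d. t ^ d *\<^sub>R g d) sums \<phi> t"
    using assms unfolding eventually_nhds_metric by (auto simp: dist_real_def)
  have "((\<lambda>t. (inverse (t ^ n) *\<^sub>R (\<phi> t - (\<Sum>d<n. t ^ d *\<^sub>R g d))) \<bullet> b) \<longlongrightarrow> g n \<bullet> b) (at 0)" for b
  proof -
    have "((\<lambda>t. (inverse (t ^ n) *\<^sub>R (\<phi> t - (\<Sum>d<n. t ^ d *\<^sub>R g d))) \<bullet> b) \<longlongrightarrow> g (0 + n) \<bullet> b) (at 0)"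
    proof (rule powser_limit_0_strong[OF \<delta>(1), of "\<lambda>d. g (d + n) \<bullet> b"])
      fix t :: real assume t: "t \<noteq> 0" "norm t < \<delta>"
      then have "(\<lambda>d. t ^ (d + n) *\<^sub>R g (d + n)) sums (\<phi> t - (\<Sum>d<n. t ^ d *\<^sub>R g d))"
        using \<delta>(2) by (intro sums_split_initial_segment) auto
      then have "(\<lambda>d. (inverse (t ^ n) *\<^sub>R t ^ (d + n) *\<^sub>R g (d + n)) \<bullet> b)
          sums ((inverse (t ^ n) *\<^sub>R (\<phi> t - (\<Sum>d<n. t ^ d *\<^sub>R g d))) \<bullet> b)"
        by (intro bounded_linear.sums[OF bounded_linear_inner_left] sums_scaleR_right)
      then show "(\<lambda>d. g (d + n) \<bullet> b * t ^ d)
          sums ((inverse (t ^ n) *\<^sub>R (\<phi> t - (\<Sum>d<n. t ^ d *\<^sub>R g d))) \<bullet> b)"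
        using t by (simp add: power_add field_simps)
    qed
    then show ?thesis by simp
  qed
  then show ?thesis
    by (subst tendsto_componentwise_iff) auto
qed

text \<open>On each line the coefficients are successive limits of remainders: once the lower
  degrees agree, both remainders of order \<open>d\<close> are the same function.\<close>

lemma power_series_hom_poly_unique:
  fixes \<Phi> :: "(nat \<Rightarrow> real) \<Rightarrow> 'b::euclidean_space"
  assumes "power_series_at_origin m \<Phi> c" "power_series_at_origin m \<Phi> c'"
  shows "hom_poly m d c = hom_poly m d c'"
proof (rule homogeneous_eqI[OF homogeneous_hom_poly homogeneous_hom_poly])
  fix v assume v: "v \<in> Rn m"
  note lim = power_series_remainder_tendsto[OF power_series_along_line[OF _ v]]
  show "hom_poly m d c v = hom_poly m d c' v"
  proof (induction d rule: less_induct)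
    case (less d)
    then have "(\<Sum>e<d. t ^ e *\<^sub>R hom_poly m e c v) = (\<Sum>e<d. t ^ e *\<^sub>R hom_poly m e c' v)" for t :: real
      by (intro sum.cong) auto
    then show ?case
      using lim[OF assms(1), of d] lim[OF assms(2), of d] by (auto intro: tendsto_unique[rotated])
  qed
qed

lemma taylor_part_eq:
  fixes \<Phi> :: "(nat \<Rightarrow> real) \<Rightarrow> 'b::euclidean_space"
  assumes "power_series_at_origin m \<Phi> c"
  shows "taylor_part m d \<Phi> = hom_poly m d c"
  unfolding taylor_part_def
  using assms power_series_hom_poly_unique by (intro the_equality) blast+

lemma power_series_at_origin_cong:
  fixes \<Phi> :: "(nat \<Rightarrow> real) \<Rightarrow> 'b::euclidean_space"
  assumes "power_series_at_origin m \<Phi> c" "\<And>x. x \<in> Rn m \<Longrightarrow> \<Phi> x = \<Psi> x"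
  shows "power_series_at_origin m \<Psi> c"
  using assms(1) eventually_near_origin_box[OF zero_less_one, of m] unfolding power_series_at_origin_def
  by eventually_elim (use assms(2) in auto)

section \<open>Convergence under geometric coefficient bounds\<close>

lemma summable_geometric_multi_indices:
  "(\<lambda>\<alpha>. \<Prod>i<m. (1 / 2 :: real) ^ \<alpha> i) summable_on multi_indices m"
proof (rule nonneg_bdd_above_summable_on)
  show "bdd_above (sum (\<lambda>\<alpha>. \<Prod>i<m. (1 / 2 :: real) ^ \<alpha> i) ` {F. F \<subseteq> multi_indices m \<and> finite F})"
  proof (rule bdd_aboveI2)
    fix F assume "F \<in> {F. F \<subseteq> multi_indices m \<and> finite F}"
    then have F: "F \<subseteq> multi_indices m" "finite F" by auto
    \<comment> \<open>\<open>N\<close> is a crude bound on all exponents in \<open>F\<close>. It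
      places \<open>F\<close> in a finite box, over which the sum factors into \<open>m\<close>
      geometric sums, each at most 2.\<close>
    define N where "N = (\<Sum>\<alpha>\<in>F. \<Sum>i<m. \<alpha> i)"
    have N: "\<alpha> i \<le> N" if "\<alpha> \<in> F" "i < m" for \<alpha> i
    proof -
      have "\<alpha> i \<le> (\<Sum>i<m. \<alpha> i)" using that by (intro member_le_sum) auto
      also have "\<dots> \<le> N" unfolding N_def
        using that F by (intro member_le_sum[of \<alpha> F "\<lambda>\<alpha>. \<Sum>i<m. \<alpha> i"]) auto
      finally show ?thesis .
    qed
    \<comment> \<open>Members of \<open>PiE\<close> are \<open>undefined\<close> off the index set,
      where multi-indices vanish; restriction passes from one convention to the other and loses
      nothing.\<close>
    let ?r = "\<lambda>\<alpha>. restrict \<alpha> {..<m}"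
    let ?w = "\<lambda>\<alpha>. \<Prod>i<m. (1 / 2 :: real) ^ \<alpha> i"
    have inj: "inj_on ?r F"
    proof (rule inj_onI, rule ext)
      fix \<alpha> \<beta> i assume "\<alpha> \<in> F" "\<beta> \<in> F" "?r \<alpha> = ?r \<beta>"
      moreover from this have "\<alpha> \<in> multi_indices m" "\<beta> \<in> multi_indices m"
        using F by auto
      ultimately show "\<alpha> i = \<beta> i"
        by (cases "i < m") (auto simp: multi_indices_def dest: fun_cong[of _ _ i])
    qed
    have "sum ?w F = sum ?w (?r ` F)"
      by (simp add: sum.reindex[OF inj])
    also have "\<dots> \<le> sum ?w (PiE {..<m} (\<lambda>_. {..N}))"
    proof (rule sum_mono2)
      show "?r ` F \<subseteq> PiE {..<m} (\<lambda>_. {..N})"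
        using N by (intro image_subsetI) (simp only: restrict_PiE_iff, auto)
    qed (auto simp: finite_PiE intro!: prod_nonneg)
    also have "\<dots> = (\<Prod>i<m. \<Sum>k\<le>N. (1 / 2) ^ k)"
      by (rule prod_sum_PiE[symmetric]) auto
    also have "\<dots> \<le> (\<Prod>i<m. 2)"
    proof (rule prod_mono)
      have "(\<Sum>k\<le>N. (1 / 2 :: real) ^ k) \<le> (\<Sum>k. (1 / 2) ^ k)"
        by (rule sum_le_suminf) (auto intro: summable_geometric)
      then show "0 \<le> (\<Sum>k\<le>N. (1 / 2 :: real) ^ k) \<and> (\<Sum>k\<le>N. (1 / 2 :: real) ^ k) \<le> 2"
        by (simp add: suminf_geometric sum_nonneg)
    qed
    finally show "sum ?w F \<le> 2 ^ m" by simp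
  qed
qed (auto intro!: prod_nonneg)

text \<open>For \<open>x\<close> in this box the term at \<open>\<alpha>\<close> is dominated by
  \<open>C\<close> times a product of powers of 1/2.\<close>

lemma summable_on_of_geometric_bound:
  fixes c :: "(nat \<Rightarrow> nat) \<Rightarrow> 'b::euclidean_space"
  assumes c: "\<And>\<alpha>. \<alpha> \<in> multi_indices m \<Longrightarrow> norm (c \<alpha>) \<le> C * R ^ (\<Sum>i<m. \<alpha> i)"
    and R: "R > 0" and x: "\<And>i. i < m \<Longrightarrow> \<bar>x i\<bar> \<le> 1 / (2 * R)"
  shows "(\<lambda>\<alpha>. monomial m \<alpha> x *\<^sub>R c \<alpha>) summable_on multi_indices m"
proof -
  \<comment> \<open>The zero multi-index has degree 0, so there the bound compares a norm with
    \<open>C\<close> itself.\<close>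
  have C: "0 \<le> C"
    using order_trans[OF norm_ge_zero c[of "\<lambda>_. 0"]] by (simp add: multi_indices_def)
  have "(\<lambda>\<alpha>. norm (C * (\<Prod>i<m. (1 / 2 :: real) ^ \<alpha> i))) summable_on multi_indices m"
    using summable_on_cmult_right[OF summable_geometric_multi_indices, of C m] C
    by (simp add: prod_nonneg abs_mult)
  then have "(\<lambda>\<alpha>. norm (monomial m \<alpha> x *\<^sub>R c \<alpha>)) summable_on multi_indices m"
  proof (rule Infinite_Sum.abs_summable_on_comparison_test)
    fix \<alpha> assume \<alpha>: "\<alpha> \<in> multi_indices m"
    have "norm (monomial m \<alpha> x *\<^sub>R c \<alpha>) \<le> \<bar>monomial m \<alpha> x\<bar> * (C * R ^ (\<Sum>i<m. \<alpha> i))"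
      using c[OF \<alpha>] by (simp add: mult_left_mono)
    also have "\<dots> = C * (\<Prod>i<m. (R * \<bar>x i\<bar>) ^ \<alpha> i)"
      by (simp add: monomial_def abs_prod power_abs power_mult_distrib prod.distrib power_sum)
    also have "\<dots> \<le> C * (\<Prod>i<m. (1 / 2) ^ \<alpha> i)"
    proof (intro mult_left_mono prod_mono conjI power_mono C)
      fix i assume "i \<in> {..<m}"
      then show "R * \<bar>x i\<bar> \<le> 1 / 2" using x[of i] R by (simp add: field_simps)
    qed (use R in auto)
    also have "\<dots> = norm (C * (\<Prod>i<m. (1 / 2) ^ \<alpha> i))"
      using C by (simp add: prod_nonneg abs_mult)
    finally show "norm (monomial m \<alpha> x *\<^sub>R c \<alpha>) \<le> norm (C * (\<Prod>i<m. (1 / 2) ^ \<alpha> i))" .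
  qed
  then show ?thesis by (rule Infinite_Sum.abs_summable_summable)
qed

section \<open>Power series of a quotient by \<open>1 + q\<close>\<close>

lemma has_sum_sum:
  fixes f :: "'a \<Rightarrow> 'c \<Rightarrow> 'b::topological_comm_monoid_add"
  assumes "\<And>i. i \<in> I \<Longrightarrow> (f i has_sum s i) A"
  shows "((\<lambda>x. \<Sum>i\<in>I. f i x) has_sum (\<Sum>i\<in>I. s i)) A"
  using assms by (induction I rule: infinite_finite_induct) (auto intro: has_sum_add)

lemma has_sum_hom_poly:
  fixes c :: "(nat \<Rightarrow> nat) \<Rightarrow> 'b::euclidean_space"
  shows "((\<lambda>\<alpha>. monomial m \<alpha> x *\<^sub>R (if (\<Sum>i<m. \<alpha> i) = d then c \<alpha> else 0)) has_sum hom_poly m d c x)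
    (multi_indices m)"
proof -
  have "((\<lambda>\<alpha>. monomial m \<alpha> x *\<^sub>R c \<alpha>) has_sum hom_poly m d c x) (degree_indices m d)"
    unfolding hom_poly_def by (rule has_sum_finite[OF finite_degree_indices])
  then show ?thesis
    by (rule has_sum_cong_neutral[THEN iffD1, rotated -1]) auto
qed

text \<open>Multiplying by a monomial shifts exponents by \<open>\<beta>\<close>. The guard
  \<open>\<beta> \<le> \<gamma>\<close> matters because subtraction of naturals truncates.\<close>

lemma has_sum_monomial_shift:
  fixes c :: "(nat \<Rightarrow> nat) \<Rightarrow> 'b::euclidean_space"
  assumes "((\<lambda>\<alpha>. monomial m \<alpha> x *\<^sub>R c \<alpha>) has_sum S) (multi_indices m)" "\<beta> \<in> multi_indices m"
  shows "((\<lambda>\<gamma>. if \<beta> \<le> \<gamma> then monomial m \<gamma> x *\<^sub>R c (\<lambda>i. \<gamma> i - \<beta> i) else 0) has_sum monomial m \<beta> x *\<^sub>R S)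
    (multi_indices m)"
proof -
  let ?h = "\<lambda>\<alpha> i. \<alpha> i + \<beta> i"
  let ?g = "\<lambda>\<gamma>. monomial m \<gamma> x *\<^sub>R c (\<lambda>i. \<gamma> i - \<beta> i)"
  have "((\<lambda>\<alpha>. ?g (?h \<alpha>)) has_sum monomial m \<beta> x *\<^sub>R S) (multi_indices m)"
    using has_sum_scaleR[OF assms(1), of "monomial m \<beta> x"]
    by (simp add: monomial_add mult.commute)
  moreover have "inj_on ?h (multi_indices m)"
    by (auto simp: inj_on_def fun_eq_iff)
  ultimately have "(?g has_sum monomial m \<beta> x *\<^sub>R S) (?h ` multi_indices m)"
    by (simp add: has_sum_reindex o_def)
  moreover have "\<gamma> \<in> ?h ` multi_indices m \<longleftrightarrow> \<gamma> \<in> multi_indices m \<and> \<beta> \<le> \<gamma>" for \<gamma>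
  proof
    assume "\<gamma> \<in> multi_indices m \<and> \<beta> \<le> \<gamma>"
    then show "\<gamma> \<in> ?h ` multi_indices m"
      using assms(2)
      by (intro image_eqI[of _ _ "\<lambda>i. \<gamma> i - \<beta> i"]) (auto simp: multi_indices_def le_fun_def)
  qed (use assms(2) in \<open>auto simp: multi_indices_def le_fun_def\<close>)
  ultimately show ?thesis
    by (elim has_sum_cong_neutral[THEN iffD1, rotated -1]) auto
qed

text \<open>
  The coefficients of \<open>N / (1 + q)\<close>, where \<open>num\<close> are those of \<open>N\<close> and \<open>q\<close> is a quadratic form: compare
  coefficients in \<open>(1 + q) S = N\<close>.
\<close>

function quotient_coeff ::
    "nat \<Rightarrow> ((nat \<Rightarrow> nat) \<Rightarrow> real) \<Rightarrow> ((nat \<Rightarrow> nat) \<Rightarrow> 'b::real_vector) \<Rightarrow> (nat \<Rightarrow> nat) \<Rightarrow> 'b"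
  where "quotient_coeff m q num \<gamma> = num \<gamma> -
    (\<Sum>\<beta> | \<beta> \<in> degree_indices m 2 \<and> \<beta> \<le> \<gamma>. q \<beta> *\<^sub>R quotient_coeff m q num (\<lambda>i. \<gamma> i - \<beta> i))"
  by auto

lemma degree_diff:
  fixes \<beta> \<gamma> :: "nat \<Rightarrow> nat"
  assumes "\<beta> \<le> \<gamma>"
  shows "(\<Sum>i<m. \<gamma> i - \<beta> i) + (\<Sum>i<m. \<beta> i) = (\<Sum>i<m. \<gamma> i)"
  using assms by (simp add: le_fun_def flip: sum.distrib)

termination
proof (relation "Wellfounded.measure (\<lambda>(m, q, num, \<gamma>). \<Sum>i<m. \<gamma> i)")
  fix m :: nat and q :: "(nat \<Rightarrow> nat) \<Rightarrow> real" and num :: "(nat \<Rightarrow> nat) \<Rightarrow> 'b" and \<gamma> \<beta> :: "nat \<Rightarrow> nat"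
  assume "\<beta> \<in> {\<beta>. \<beta> \<in> degree_indices m 2 \<and> \<beta> \<le> \<gamma>}"
  then show "((m, q, num, \<lambda>i. \<gamma> i - \<beta> i), m, q, num, \<gamma>) \<in> Wellfounded.measure (\<lambda>(m, q, num, \<gamma>). \<Sum>i<m. \<gamma> i)"
    using degree_diff[of \<beta> \<gamma> m] by auto
qed auto

declare quotient_coeff.simps [simp del]

lemma quotient_coeff_low_degree:
  assumes "(\<Sum>i<m. \<gamma> i) < 2"
  shows "quotient_coeff m q num \<gamma> = num \<gamma>"
proof -
  have "{\<beta>. \<beta> \<in> degree_indices m 2 \<and> \<beta> \<le> \<gamma>} = {}"
    using assms degree_diff[of _ \<gamma> m] by fastforce
  then show ?thesis by (subst quotient_coeff.simps) (simp only: sum.empty diff_zero)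
qed

text \<open>Only \<open>\<beta> = \<gamma>\<close> fits below \<open>\<gamma>\<close>, which leaves
  the constant term of \<open>num\<close>. For a numerator without constant term, the division does
  not alter degree 2.\<close>

lemma quotient_coeff_degree_2:
  assumes "\<gamma> \<in> degree_indices m 2"
  shows "quotient_coeff m q num \<gamma> = num \<gamma> - q \<gamma> *\<^sub>R num (\<lambda>_. 0)"
proof -
  have "\<beta> = \<gamma>" if "\<beta> \<in> degree_indices m 2" "\<beta> \<le> \<gamma>" for \<beta>
  proof
    fix i
    have "(\<Sum>i<m. \<gamma> i - \<beta> i) = 0" using degree_diff[OF that(2), of m] that assms by simp
    then have "i < m \<Longrightarrow> \<gamma> i \<le> \<beta> i" by simp
    then show "\<beta> i = \<gamma> i"
      using that assms by (cases "i < m") (auto simp: multi_indices_def le_fun_def intro: antisym)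
  qed
  then have "{\<beta>. \<beta> \<in> degree_indices m 2 \<and> \<beta> \<le> \<gamma>} = {\<gamma>}"
    using assms by auto
  then show ?thesis
    by (subst quotient_coeff.simps) (simp add: quotient_coeff_low_degree)
qed

text \<open>A recursive call lowers the degree by 2, and the coefficients of \<open>q\<close> cost
  at most \<open>R\<^sup>2 / 2\<close>; hence the recursive sum uses at most half of the bound. The
  term \<open>num \<gamma>\<close> fits into the other half since \<open>R \<ge> 1\<close>.\<close>

lemma quotient_coeff_bound:
  fixes num :: "(nat \<Rightarrow> nat) \<Rightarrow> 'b::euclidean_space"
  assumes num: "\<And>\<alpha>. norm (num \<alpha>) \<le> N" and R: "R \<ge> 1"
    "2 * (\<Sum>\<beta>\<in>degree_indices m 2. \<bar>q \<beta>\<bar>) \<le> R\<^sup>2"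
  shows "norm (quotient_coeff m q num \<gamma>) \<le> 2 * N * R ^ (\<Sum>i<m. \<gamma> i)"
proof (induction "\<Sum>i<m. \<gamma> i" arbitrary: \<gamma> rule: less_induct)
  case less
  let ?B = "{\<beta>. \<beta> \<in> degree_indices m 2 \<and> \<beta> \<le> \<gamma>}"
  let ?n = "\<Sum>i<m. \<gamma> i"
  have N: "0 \<le> N" using order_trans[OF norm_ge_zero num] .
  have "norm (\<Sum>\<beta>\<in>?B. q \<beta> *\<^sub>R quotient_coeff m q num (\<lambda>i. \<gamma> i - \<beta> i)) \<le> N * R ^ ?n"
  proof (cases "?n < 2")
    case True
    then have "?B = {}" using degree_diff[of _ \<gamma> m] by fastforce
    then show ?thesis using N R by (simp only: sum.empty norm_zero) simp
  next
    case False
    have "norm (\<Sum>\<beta>\<in>?B. q \<beta> *\<^sub>R quotient_coeff m q num (\<lambda>i. \<gamma> i - \<beta> i))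
        \<le> (\<Sum>\<beta>\<in>?B. \<bar>q \<beta>\<bar> * (2 * N * R ^ (?n - 2)))"
    proof (rule sum_norm_le)
      fix \<beta> assume "\<beta> \<in> ?B"
      then have deg: "(\<Sum>i<m. \<gamma> i - \<beta> i) = ?n - 2" using degree_diff[of \<beta> \<gamma> m] by simp
      show "norm (q \<beta> *\<^sub>R quotient_coeff m q num (\<lambda>i. \<gamma> i - \<beta> i)) \<le> \<bar>q \<beta>\<bar> * (2 * N * R ^ (?n - 2))"
        using less[of "\<lambda>i. \<gamma> i - \<beta> i"] False unfolding deg by (simp add: mult_left_mono)
    qed
    also have "\<dots> \<le> (\<Sum>\<beta>\<in>degree_indices m 2. \<bar>q \<beta>\<bar> * (2 * N * R ^ (?n - 2)))"
      using N R by (intro sum_mono2 finite_degree_indices) auto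
    also have "\<dots> = (2 * (\<Sum>\<beta>\<in>degree_indices m 2. \<bar>q \<beta>\<bar>)) * (N * R ^ (?n - 2))"
      by (simp add: sum_distrib_left sum_distrib_right mult_ac)
    also have "\<dots> \<le> R\<^sup>2 * (N * R ^ (?n - 2))"
      using R N by (intro mult_right_mono) auto
    also have "\<dots> = N * R ^ (2 + (?n - 2))"
      by (simp only: power_add mult_ac)
    also have "\<dots> = N * R ^ ?n"
      using False by (simp only: le_add_diff_inverse not_less)
    finally show ?thesis .
  qed
  moreover have "norm (num \<gamma>) \<le> N * R ^ ?n"
    using num[of \<gamma>] N R one_le_power[of R ?n] mult_left_mono[of 1 "R ^ ?n" N] by simp
  ultimately show ?case
    by (subst quotient_coeff.simps) (rule order_trans[OF norm_triangle_ineq4], simp)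
qed

text \<open>With both sums given, it remains to compare coefficients: each monomial of the quadratic
  form shifts the series of \<open>S\<close>, and the recursion for \<open>quotient_coeff\<close>
  collapses the total to \<open>num\<close>.\<close>

lemma has_sum_quotient:
  fixes num :: "(nat \<Rightarrow> nat) \<Rightarrow> 'b::euclidean_space"
  assumes "((\<lambda>\<alpha>. monomial m \<alpha> x *\<^sub>R num \<alpha>) has_sum N) (multi_indices m)"
    and "((\<lambda>\<alpha>. monomial m \<alpha> x *\<^sub>R quotient_coeff m q num \<alpha>) has_sum S) (multi_indices m)"
  shows "(1 + hom_poly m 2 q x) *\<^sub>R S = N"
proof -
  let ?c = "quotient_coeff m q num"
  let ?t = "\<lambda>\<gamma>. \<Sum>\<beta>\<in>degree_indices m 2.
    q \<beta> *\<^sub>R (if \<beta> \<le> \<gamma> then monomial m \<gamma> x *\<^sub>R ?c (\<lambda>i. \<gamma> i - \<beta> i) else 0)"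
  have "(?t has_sum (\<Sum>\<beta>\<in>degree_indices m 2. q \<beta> *\<^sub>R monomial m \<beta> x *\<^sub>R S)) (multi_indices m)"
    by (intro has_sum_sum has_sum_scaleR has_sum_monomial_shift assms(2)) auto
  from has_sum_add[OF assms(2) this]
  have "((\<lambda>\<gamma>. monomial m \<gamma> x *\<^sub>R ?c \<gamma> + ?t \<gamma>) has_sum (1 + hom_poly m 2 q x) *\<^sub>R S) (multi_indices m)"
    by (simp add: hom_poly_def scaleR_sum_left scaleR_add_left mult.commute)
  moreover have "monomial m \<gamma> x *\<^sub>R ?c \<gamma> + ?t \<gamma> = monomial m \<gamma> x *\<^sub>R num \<gamma>" for \<gamma>
  proof -
    have "?t \<gamma> = (\<Sum>\<beta>\<in>degree_indices m 2. if \<beta> \<le> \<gamma> then monomial m \<gamma> x *\<^sub>R q \<beta> *\<^sub>R ?c (\<lambda>i. \<gamma> i - \<beta> i) else 0)"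
      by (intro sum.cong) (auto simp: mult.commute)
    also have "\<dots> = (\<Sum>\<beta> | \<beta> \<in> degree_indices m 2 \<and> \<beta> \<le> \<gamma>. monomial m \<gamma> x *\<^sub>R q \<beta> *\<^sub>R ?c (\<lambda>i. \<gamma> i - \<beta> i))"
      by (subst sum.inter_filter[symmetric, OF finite_degree_indices]) simp
    finally have "?t \<gamma> = monomial m \<gamma> x *\<^sub>R
        (\<Sum>\<beta> | \<beta> \<in> degree_indices m 2 \<and> \<beta> \<le> \<gamma>. q \<beta> *\<^sub>R ?c (\<lambda>i. \<gamma> i - \<beta> i))"
      by (simp only: scaleR_sum_right)
    then show ?thesis
      by (subst quotient_coeff.simps) (simp add: scaleR_diff_right)
  qed
  ultimately show ?thesis
    using has_sum_unique assms(1) by (auto cong: has_sum_cong)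
qed

text \<open>As \<open>q\<close> is nonnegative, the denominator is at least 1 and
  \<open>(1 + q) S = A + B\<close> can be solved for \<open>S\<close>. The numerator starts in
  degree 1, so \<open>q\<close> first has an effect in degree 3 and the 2-jet stays
  \<open>A + B\<close>.\<close>

lemma power_series_quotient:
  fixes A B :: "(nat \<Rightarrow> real) \<Rightarrow> 'b::euclidean_space"
  assumes A: "homogeneous m 1 A" and B: "homogeneous m 2 B" and q: "homogeneous m 2 q"
    and q_ge: "\<And>x. x \<in> Rn m \<Longrightarrow> q x \<ge> 0"
  obtains c where "power_series_at_origin m (\<lambda>x. (A x + B x) /\<^sub>R (1 + q x)) c"
    "hom_poly m 1 c = A" "hom_poly m 2 c = B"
proof -
  obtain a b r where abr: "A = hom_poly m 1 a" "B = hom_poly m 2 b" "q = hom_poly m 2 r"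
    using A B q by (auto simp: homogeneous_def)
  define num where "num \<alpha> = (if \<alpha> \<in> degree_indices m 1 then a \<alpha> else 0)
    + (if \<alpha> \<in> degree_indices m 2 then b \<alpha> else 0)" for \<alpha>
  define c where "c = quotient_coeff m r num"
  define N where "N = (\<Sum>\<alpha>\<in>degree_indices m 1. norm (a \<alpha>)) + (\<Sum>\<alpha>\<in>degree_indices m 2. norm (b \<alpha>))"
  have num: "norm (num \<alpha>) \<le> N" for \<alpha>
  proof -
    have "norm (if \<alpha> \<in> degree_indices m d then f \<alpha> else 0) \<le> (\<Sum>\<alpha>\<in>degree_indices m d. norm (f \<alpha>))"
      for d and f :: "_ \<Rightarrow> 'b"
      using member_le_sum[OF _ _ finite_degree_indices, of \<alpha> m d "\<lambda>\<alpha>. norm (f \<alpha>)"]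
      by (auto intro!: sum_nonneg simp del: One_nat_def)
    then show ?thesis
      unfolding num_def N_def by (intro order_trans[OF norm_triangle_ineq] add_mono)
  qed
  define Q where "Q = (\<Sum>\<beta>\<in>degree_indices m 2. \<bar>r \<beta>\<bar>)"
  \<comment> \<open>This choice gives \<open>R \<ge> 1\<close> and, as \<open>Q \<ge> 0\<close>,
    also \<open>2 * Q \<le> R\<^sup>2\<close>, the two conditions of the coefficient bound.\<close>
  define R where "R = 1 + 2 * Q"
  have Q: "Q \<ge> 0" unfolding Q_def by (auto intro: sum_nonneg)
  have R: "R \<ge> 1" "2 * Q \<le> R\<^sup>2"
    using Q by (auto simp: R_def power2_eq_square algebra_simps intro!: add_nonneg_nonneg mult_nonneg_nonneg)
  have bound: "norm (c \<alpha>) \<le> 2 * N * R ^ (\<Sum>i<m. \<alpha> i)" for \<alpha>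
    unfolding c_def using num R by (intro quotient_coeff_bound) (auto simp: Q_def)
  have "power_series_at_origin m (\<lambda>x. (A x + B x) /\<^sub>R (1 + q x)) c"
    unfolding power_series_at_origin_def
    using eventually_near_origin_box[of "1 / (2 * R)" m]
  proof (rule eventually_mono)
    fix x assume x: "x \<in> Rn m \<and> (\<forall>i<m. \<bar>x i\<bar> < 1 / (2 * R))"
    have "(\<lambda>\<alpha>. monomial m \<alpha> x *\<^sub>R c \<alpha>) summable_on multi_indices m"
      by (rule summable_on_of_geometric_bound[OF bound]) (use R x in \<open>auto intro: less_imp_le\<close>)
    then obtain S where S: "((\<lambda>\<alpha>. monomial m \<alpha> x *\<^sub>R c \<alpha>) has_sum S) (multi_indices m)"
      by (auto simp: summable_on_def)
    have "((\<lambda>\<alpha>. monomial m \<alpha> x *\<^sub>R num \<alpha>) has_sum A x + B x) (multi_indices m)"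
      unfolding abr
      by (rule has_sum_cong[THEN iffD1, OF _ has_sum_add[OF has_sum_hom_poly has_sum_hom_poly]])
         (auto simp: num_def)
    then have "(1 + q x) *\<^sub>R S = A x + B x"
      using has_sum_quotient S unfolding c_def abr by blast
    then have "S = (A x + B x) /\<^sub>R (1 + q x)"
      using q_ge[of x] x by (simp flip: \<open>(1 + q x) *\<^sub>R S = A x + B x\<close>)
    then show "((\<lambda>\<alpha>. monomial m \<alpha> x *\<^sub>R c \<alpha>) has_sum (A x + B x) /\<^sub>R (1 + q x)) (multi_indices m)"
      using S by simp
  qed (use R in auto)
  moreover have "hom_poly m 1 c = A"
    unfolding abr hom_poly_def c_def
    by (intro ext sum.cong) (auto simp: quotient_coeff_low_degree num_def)
  moreover have "hom_poly m 2 c = B"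
    unfolding abr hom_poly_def c_def
    by (intro ext sum.cong) (auto simp: quotient_coeff_degree_2 num_def)
  ultimately show ?thesis by (rule that)
qed

subsection \<open>Circles and 2-jets\<close>

text \<open>An affine set through 0 is a closed subspace. It contains the first difference
  quotients, hence their limit \<open>a\<close>, hence also the second difference quotients and
  \<open>b\<close>.\<close>

lemma second_order_limits_in_affine:
  fixes a b :: "'b::euclidean_space"
  assumes L: "affine L" "0 \<in> L" "\<forall>\<^sub>F t in at 0. \<phi> (t::real) \<in> L"
    and lim1: "((\<lambda>t. \<phi> t /\<^sub>R t) \<longlongrightarrow> a) (at 0)"
    and lim2: "((\<lambda>t. (\<phi> t - t *\<^sub>R a) /\<^sub>R t\<^sup>2) \<longlongrightarrow> b) (at 0)"
  shows "x *\<^sub>R a + y *\<^sub>R b \<in> L"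
proof -
  have sub: "subspace L" using L by (simp add: subspace_affine)
  then have "closed L" by (rule closed_subspace)
  have "a \<in> L"
    using L(3) by (intro Lim_in_closed_set[OF \<open>closed L\<close> _ _ lim1])
      (auto elim!: eventually_mono intro: subspace_scale[OF sub])
  moreover from this have "b \<in> L"
    using L(3) by (intro Lim_in_closed_set[OF \<open>closed L\<close> _ _ lim2])
      (auto elim!: eventually_mono intro!: subspace_scale[OF sub] subspace_diff[OF sub])
  ultimately show ?thesis
    by (intro subspace_add subspace_scale sub)
qed

text \<open>Passing from \<open>b\<close> to \<open>b'\<close> removes the component along the
  tangent \<open>a\<close>. The point lies in every affine set containing \<open>C\<close>, which
  settles lines and points. For a round circle, expanding the sphere equation to second order gives
  the inner products of \<open>a\<close> and \<open>b\<close> with the centre.\<close>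

lemma circle_of_2_jet:
  fixes a b :: "'b::euclidean_space"
  assumes C: "circle C" "\<forall>\<^sub>F t in nhds 0. \<phi> (t::real) \<in> C" "\<phi> 0 = 0"
    and lim1: "((\<lambda>t. \<phi> t /\<^sub>R t) \<longlongrightarrow> a) (at 0)"
    and lim2: "((\<lambda>t. (\<phi> t - t *\<^sub>R a) /\<^sub>R t\<^sup>2) \<longlongrightarrow> b) (at 0)"
    and a: "a \<noteq> 0" and b': "b' = b - p *\<^sub>R a" "a \<bullet> b' = 0" "b' \<bullet> b' = q * (a \<bullet> a)" "q \<ge> 0"
  shows "(t *\<^sub>R a + t\<^sup>2 *\<^sub>R b') /\<^sub>R (1 + t\<^sup>2 * q) \<in> C"
proof -
  define s where "s = 1 + t\<^sup>2 * q"
  have s: "s > 0" using b'(4) by (auto simp: s_def intro: add_pos_nonneg)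
  define y where "y = (t *\<^sub>R a + t\<^sup>2 *\<^sub>R b') /\<^sub>R s"
  have "y = (inverse s * (t - t\<^sup>2 * p)) *\<^sub>R a + (inverse s * t\<^sup>2) *\<^sub>R b"
    by (simp add: y_def b'(1) algebra_simps)
  then have in_affine: "y \<in> L" if "affine L" "C \<subseteq> L" for L
    using that eventually_nhds_x_imp_x[OF C(2)] C(3)
      eventually_mono[OF filter_leD[OF at_within_le_nhds C(2), of UNIV], of "\<lambda>t. \<phi> t \<in> L"]
    by (auto intro!: second_order_limits_in_affine[OF _ _ _ lim1 lim2])
  \<comment> \<open>A single point is affine, so lines and points form one case.\<close>
  consider c r L where "affine L" "C = sphere c r \<inter> L" | "affine C"
    using C(1) unfolding circle_def by (auto intro: affine_sing)
  then have "y \<in> C"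
  proof cases
    case (1 c r L)
    have "y \<in> L" using 1 by (intro in_affine) auto
    \<comment> \<open>The origin lies on the circle, so the sphere equation has no constant
      term.\<close>
    have r: "norm c = r"
      using eventually_nhds_x_imp_x[OF C(2)] C(3) 1(2) by (simp add: dist_norm)
    have on_sphere: "x \<in> sphere c r \<longleftrightarrow> x \<bullet> c = (x \<bullet> x) / 2" for x
      unfolding r[symmetric] by (auto simp: dist_norm norm_eq_sqrt_inner inner_diff inner_commute)
    have ev: "\<forall>\<^sub>F t in at 0. t \<noteq> 0 \<and> \<phi> t \<bullet> c = (\<phi> t \<bullet> \<phi> t) / 2"
      using filter_leD[OF at_within_le_nhds C(2), of UNIV] eventually_neq_at_within[of 0]
      by eventually_elim (use 1(2) on_sphere in auto)
    \<comment> \<open>Dividing the sphere equation by \<open>t\<close> leaves a factor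
      \<open>t\<close> on the right, so the tangent is perpendicular to the centre
      \<open>c\<close>.\<close>
    have "((\<lambda>t. (\<phi> t /\<^sub>R t) \<bullet> c) \<longlongrightarrow> 0) (at 0)"
    proof (rule Lim_transform_eventually)
      have "((\<lambda>t. t / 2 * ((\<phi> t /\<^sub>R t) \<bullet> (\<phi> t /\<^sub>R t))) \<longlongrightarrow> 0 / 2 * (a \<bullet> a)) (at 0)"
        by (intro tendsto_intros lim1) auto
      then show "((\<lambda>t. t / 2 * ((\<phi> t /\<^sub>R t) \<bullet> (\<phi> t /\<^sub>R t))) \<longlongrightarrow> 0) (at 0)" by simp
      show "\<forall>\<^sub>F t in at 0. t / 2 * ((\<phi> t /\<^sub>R t) \<bullet> (\<phi> t /\<^sub>R t)) = (\<phi> t /\<^sub>R t) \<bullet> c"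
        using ev by eventually_elim (auto simp: field_simps)
    qed
    moreover have "((\<lambda>t. (\<phi> t /\<^sub>R t) \<bullet> c) \<longlongrightarrow> a \<bullet> c) (at 0)"
      by (intro tendsto_intros lim1)
    ultimately have ac: "a \<bullet> c = 0" by (rule tendsto_unique[OF trivial_limit_at, rotated])
    \<comment> \<open>Dividing by \<open>t\<^sup>2\<close> gives a nontrivial limit; subtracting
      \<open>t *\<^sub>R a\<close> is harmless because \<open>a \<bullet> c = 0\<close>.\<close>
    have "((\<lambda>t. ((\<phi> t - t *\<^sub>R a) /\<^sub>R t\<^sup>2) \<bullet> c) \<longlongrightarrow> (a \<bullet> a) / 2) (at 0)"
    proof (rule Lim_transform_eventually)
      show "((\<lambda>t. ((\<phi> t /\<^sub>R t) \<bullet> (\<phi> t /\<^sub>R t)) / 2) \<longlongrightarrow> (a \<bullet> a) / 2) (at 0)"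
        by (intro tendsto_intros lim1) auto
      show "\<forall>\<^sub>F t in at 0. ((\<phi> t /\<^sub>R t) \<bullet> (\<phi> t /\<^sub>R t)) / 2 = ((\<phi> t - t *\<^sub>R a) /\<^sub>R t\<^sup>2) \<bullet> c"
        using ev by eventually_elim (auto simp: inner_diff ac power2_eq_square)
    qed
    moreover have "((\<lambda>t. ((\<phi> t - t *\<^sub>R a) /\<^sub>R t\<^sup>2) \<bullet> c) \<longlongrightarrow> b \<bullet> c) (at 0)"
      by (intro tendsto_intros lim2)
    ultimately have "b \<bullet> c = (a \<bullet> a) / 2" by (rule tendsto_unique[OF trivial_limit_at, rotated])
    then have "y \<bullet> c = t\<^sup>2 * (a \<bullet> a) / 2 / s"
      using s by (simp add: y_def b'(1) inner_diff_left inner_add_left ac field_simps)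
    \<comment> \<open>Orthogonality removes the mixed term, and the value of
      \<open>b' \<bullet> b'\<close> produces a factor \<open>s\<close> that cancels.\<close>
    moreover have "y \<bullet> y = t\<^sup>2 * (a \<bullet> a) / s"
    proof -
      have "y \<bullet> y = (t\<^sup>2 * (a \<bullet> a) + (t\<^sup>2)\<^sup>2 * (b' \<bullet> b')) / s\<^sup>2"
        using s b'(2) by (simp add: y_def inner_add inner_commute[of b' a] power2_eq_square field_simps)
      also have "\<dots> = t\<^sup>2 * (a \<bullet> a) * s / s\<^sup>2"
        by (simp add: b'(3) s_def power2_eq_square algebra_simps)
      also have "\<dots> = t\<^sup>2 * (a \<bullet> a) / s"
        using s by (simp add: power2_eq_square)
      finally show ?thesis .
    qed
    ultimately have "y \<in> sphere c r" unfolding on_sphere by simp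
    then show ?thesis using \<open>y \<in> L\<close> 1 by simp
  qed (rule in_affine, auto)
  then show ?thesis by (simp add: y_def s_def)
qed

section \<open>Extending relations from the dense set where \<open>A\<close> does not vanish\<close>

lemma homogeneous_1_eventually_nonzero:
  fixes A :: "(nat \<Rightarrow> real) \<Rightarrow> 'b::real_normed_vector"
  assumes A: "homogeneous m 1 A" and v: "A v \<noteq> 0"
  shows "\<forall>\<^sub>F t in at 0. A (\<lambda>i. x i + t * v i) \<noteq> 0"
proof (cases "A x = 0")
  case True
  then have "A (\<lambda>i. x i + t * v i) = t *\<^sub>R A v" for t
    using homogeneous_1_linear[OF A, of 1 x t v] by simp
  then show ?thesis
    using eventually_neq_at_within[of 0] v by (auto elim: eventually_mono)
next
  case False
  then show ?thesis
    using tendsto_imp_eventually_ne[OF homogeneous_tendsto[OF A]] by blast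
qed

text \<open>For small nonzero \<open>t\<close> the points \<open>x + t v\<close> avoid the zeros of
  \<open>A\<close>, and \<open>f\<close> is continuous along this line.\<close>

lemma homogeneous_nonneg_of_dense:
  fixes A :: "(nat \<Rightarrow> real) \<Rightarrow> 'b::real_normed_vector" and f :: "(nat \<Rightarrow> real) \<Rightarrow> real"
  assumes A: "homogeneous m 1 A" and v: "v \<in> Rn m" "A v \<noteq> 0" and f: "homogeneous m d f"
    and nonneg: "\<And>x. x \<in> Rn m \<Longrightarrow> A x \<noteq> 0 \<Longrightarrow> f x \<ge> 0" and x: "x \<in> Rn m"
  shows "f x \<ge> 0"
proof (rule tendsto_lowerbound[OF homogeneous_tendsto[OF f]])
  have mem: "(\<lambda>i. x i + t * v i) \<in> Rn m" for t
    using v x by (auto simp: topspace_Euclidean_space)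
  show "\<forall>\<^sub>F t in at 0. 0 \<le> f (\<lambda>i. x i + t * v i)"
    using homogeneous_1_eventually_nonzero[OF A v(2)] by (rule eventually_mono) (rule nonneg[OF mem])
qed auto

lemma homogeneous_eq_of_dense:
  fixes A :: "(nat \<Rightarrow> real) \<Rightarrow> 'b::real_normed_vector" and f g :: "(nat \<Rightarrow> real) \<Rightarrow> real"
  assumes A: "homogeneous m 1 A" "v \<in> Rn m" "A v \<noteq> 0"
    and fg: "homogeneous m d f" "homogeneous m d g"
    and eq: "\<And>x. x \<in> Rn m \<Longrightarrow> A x \<noteq> 0 \<Longrightarrow> f x = g x" and x: "x \<in> Rn m"
  shows "f x = g x"
  using homogeneous_nonneg_of_dense[OF A homogeneous_diff[OF fg] _ x]
    homogeneous_nonneg_of_dense[OF A homogeneous_diff[OF fg(2,1)] _ x] eq by simp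

subsection \<open>Dividing out the kernel\<close>

text \<open>This is a 2-jet whose tangential part has been removed. Its \<open>q\<close> plays the
  role of \<open>q - p\<^sup>2\<close> for a general jet, so degeneracy becomes a nonzero common
  zero of \<open>A\<close> and \<open>q\<close>.\<close>

definition normal_jet ::
    "nat \<Rightarrow> ((nat \<Rightarrow> real) \<Rightarrow> 'b::euclidean_space) \<Rightarrow> ((nat \<Rightarrow> real) \<Rightarrow> 'b) \<Rightarrow> ((nat \<Rightarrow> real) \<Rightarrow> real) \<Rightarrow> bool"
  where "normal_jet m A B q \<longleftrightarrow> homogeneous m 1 A \<and> homogeneous m 2 B \<and> homogeneous m 2 q \<and>
    (\<forall>x\<in>Rn m. A x \<bullet> B x = 0 \<and> B x \<bullet> B x = q x * (A x \<bullet> A x) \<and> q x \<ge> 0)"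

lemma affine_nonneg_imp_constant:
  fixes a b :: real
  assumes "\<And>t. a + t * b \<ge> 0"
  shows "b = 0"
proof (rule ccontr)
  assume "b \<noteq> 0"
  then show False using assms[of "- (a + 1) / b"] by simp
qed

lemma normal_jet_kernel_translate:
  assumes jet: "normal_jet m A B q" and z: "z \<in> Rn m" "A z = 0" "q z = 0" and x: "x \<in> Rn m"
  shows "A (\<lambda>i. x i + t * z i) = A x" "B (\<lambda>i. x i + t * z i) = B x" "q (\<lambda>i. x i + t * z i) = q x"
proof -
  have A: "homogeneous m 1 A" and B: "homogeneous m 2 B" and q: "homogeneous m 2 q"
    and props: "\<And>x. x \<in> Rn m \<Longrightarrow> B x \<bullet> B x = q x * (A x \<bullet> A x) \<and> q x \<ge> 0"
    using jet by (auto simp: normal_jet_def)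
  have mem: "(\<lambda>i. x i + t * z i) \<in> Rn m" for t
    using x z by (auto simp: topspace_Euclidean_space)
  show A': "A (\<lambda>i. x i + t * z i) = A x" for t
    using homogeneous_1_linear[OF A, of 1 x t z] z by simp
  obtain g where g: "\<And>t. q (\<lambda>i. x i + t * z i) = q x + t *\<^sub>R g + t\<^sup>2 *\<^sub>R q z"
    using homogeneous_2_expand[OF q] by blast
  \<comment> \<open>As \<open>q z = 0\<close>, the form \<open>q\<close> is affine in
    \<open>t\<close> on this line, and it is nonnegative for all \<open>t\<close>.\<close>
  have "g = 0"
    using affine_nonneg_imp_constant[of "q x" g] props[OF mem] g z by simp
  then show q': "q (\<lambda>i. x i + t * z i) = q x" for t
    using g z by simp
  have "B z = 0" using props[OF z(1)] z by simp
  moreover obtain h where "\<And>t. B (\<lambda>i. x i + t * z i) = B x + t *\<^sub>R h + t\<^sup>2 *\<^sub>R B z"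
    using homogeneous_2_expand[OF B] by blast
  ultimately have h: "B (\<lambda>i. x i + t * z i) = B x + t *\<^sub>R h" for t by simp
  have "(B x + t *\<^sub>R h) \<bullet> (B x + t *\<^sub>R h) = B x \<bullet> B x" for t
    using props[OF mem] props[OF x] by (simp add: A' q' flip: h)
  \<comment> \<open>Adding the equations for 1 and -1 cancels the mixed term.\<close>
  from this[of 1] this[of "-1"] have "h \<bullet> h = 0"
    by (simp add: inner_add inner_diff inner_commute)
  then show "B (\<lambda>i. x i + t * z i) = B x" using h by simp
qed

lemma linear_map_comp:
  assumes "linear_map m k f" "linear_map k l g"
  shows "linear_map m l (g \<circ> f)"
  using assms unfolding linear_map_def by (auto simp: image_subset_iff)

lemma linear_map_id: "linear_map m m id"
  by (auto simp: linear_map_def)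

text \<open>The jet is pulled back by a section \<open>\<sigma>\<close> of \<open>\<pi>\<close>.
  Since \<open>\<sigma> (\<pi> x)\<close> differs from \<open>x\<close> by a multiple of
  \<open>z\<close>, along which the jet is constant, the pullback factors the given jet.\<close>

lemma normal_jet_project_along:
  fixes A B :: "(nat \<Rightarrow> real) \<Rightarrow> 'b::euclidean_space"
  assumes jet: "normal_jet (Suc m) A B q"
    and z: "z \<in> Rn (Suc m)" "z \<noteq> origin" "A z = 0" "q z = 0"
  obtains \<pi> A' B' q' where "linear_map (Suc m) m \<pi>" "\<pi> ` Rn (Suc m) = Rn m" "normal_jet m A' B' q'"
    "\<And>x. x \<in> Rn (Suc m) \<Longrightarrow> A x = A' (\<pi> x) \<and> B x = B' (\<pi> x) \<and> q x = q' (\<pi> x)"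
proof -
  obtain j where j: "z j \<noteq> 0" using z(2) by auto
  then have jm: "j < Suc m" using z(1) by (auto simp: topspace_Euclidean_space not_less[symmetric])
  txt \<open>Project along \<open>z\<close> onto the hyperplane \<open>x j = 0\<close> and delete the \<open>j\<close>-th coordinate.\<close>
  define \<pi> where "\<pi> x = (\<lambda>i. let i' = if i < j then i else Suc i in x i' - x j / z j * z i')"
    for x :: "nat \<Rightarrow> real"
  \<comment> \<open>The section inserts a zero at index \<open>j\<close>; later coordinates move up
    by one.\<close>
  define \<sigma> where "\<sigma> y = (\<lambda>i. if i < j then y i else if i = j then 0 else y (i - 1))"
    for y :: "nat \<Rightarrow> real"
  have \<sigma>_mem: "\<sigma> y \<in> Rn (Suc m)" if "y \<in> Rn m" for y
    using that jm by (auto simp: topspace_Euclidean_space \<sigma>_def)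
  have \<pi>_mem: "\<pi> x \<in> Rn m" if "x \<in> Rn (Suc m)" for x
    using that z(1) jm by (auto simp: topspace_Euclidean_space \<pi>_def Let_def)
  have \<pi>\<sigma>: "\<pi> (\<sigma> y) = y" for y
    by (auto simp: \<pi>_def \<sigma>_def Let_def)
  have \<sigma>\<pi>: "\<sigma> (\<pi> x) = (\<lambda>i. x i + (- (x j / z j)) * z i)" for x
    using j by (auto simp: \<pi>_def \<sigma>_def Let_def fun_eq_iff)
  have \<sigma>_hom: "homogeneous m 1 (\<lambda>y. \<sigma> y i)" if "i < Suc m" for i
  proof -
    consider "i < j" | "i = j" | "i > j" by linarith
    then show ?thesis
      using that jm homogeneous_coordinate[of i m "1::real"] homogeneous_coordinate[of "i - 1" m "1::real"]
      by cases (auto simp: \<sigma>_def homogeneous_zero)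
  qed
  have "linear_map (Suc m) m \<pi>"
    using \<pi>_mem by (auto simp: linear_map_def \<pi>_def Let_def fun_eq_iff algebra_simps add_divide_distrib)
  moreover have "\<pi> ` Rn (Suc m) = Rn m"
  proof
    show "Rn m \<subseteq> \<pi> ` Rn (Suc m)"
      using \<sigma>_mem \<pi>\<sigma> by (metis image_eqI subsetI)
  qed (use \<pi>_mem in auto)
  moreover have "normal_jet m (\<lambda>y. A (\<sigma> y)) (\<lambda>y. B (\<sigma> y)) (\<lambda>y. q (\<sigma> y))"
    unfolding normal_jet_def
  proof (intro conjI ballI)
    have "homogeneous (Suc m) 1 A" "homogeneous (Suc m) 2 B" "homogeneous (Suc m) 2 q"
      using jet by (simp_all only: normal_jet_def)
    then show "homogeneous m 1 (\<lambda>y. A (\<sigma> y))" "homogeneous m 2 (\<lambda>y. B (\<sigma> y))" "homogeneous m 2 (\<lambda>y. q (\<sigma> y))"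
      using \<sigma>_hom by (blast intro: homogeneous_comp)+
  next
    fix y assume "y \<in> Rn m"
    from \<sigma>_mem[OF this]
    show "A (\<sigma> y) \<bullet> B (\<sigma> y) = 0" "B (\<sigma> y) \<bullet> B (\<sigma> y) = q (\<sigma> y) * (A (\<sigma> y) \<bullet> A (\<sigma> y))" "0 \<le> q (\<sigma> y)"
      using jet by (auto simp only: normal_jet_def)
  qed
  moreover have "A x = A (\<sigma> (\<pi> x)) \<and> B x = B (\<sigma> (\<pi> x)) \<and> q x = q (\<sigma> (\<pi> x))" if "x \<in> Rn (Suc m)" for x
    unfolding \<sigma>\<pi> normal_jet_kernel_translate[OF jet z(1,3,4) that] by simp
  ultimately show ?thesis by (rule that)
qed

text \<open>One kernel direction is divided out at a time until none is left. The last clause keeps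
  track of whether any step was made.\<close>

lemma normal_jet_reduce:
  fixes A B :: "(nat \<Rightarrow> real) \<Rightarrow> 'b::euclidean_space"
  assumes "normal_jet m A B q"
  shows "\<exists>k \<pi> A' B' q'. k \<le> m \<and> linear_map m k \<pi> \<and> \<pi> ` Rn m = Rn k \<and> normal_jet k A' B' q' \<and>
    (\<forall>x\<in>Rn m. A x = A' (\<pi> x) \<and> B x = B' (\<pi> x) \<and> q x = q' (\<pi> x)) \<and>
    (\<forall>y\<in>Rn k - {origin}. A' y = 0 \<longrightarrow> q' y \<noteq> 0) \<and>
    ((\<exists>z\<in>Rn m - {origin}. A z = 0 \<and> q z = 0) \<longrightarrow> k < m)"
  using assms
proof (induction m arbitrary: A B q)
  case 0
  have "Rn 0 = {origin}" by (auto simp: topspace_Euclidean_space)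
  with 0 show ?case
    by - (rule exI[of _ 0], rule exI[of _ id], rule exI[of _ A], rule exI[of _ B], rule exI[of _ q],
      auto simp: linear_map_id[unfolded id_def])
next
  case (Suc m)
  show ?case
  proof (cases "\<exists>z\<in>Rn (Suc m) - {origin}. A z = 0 \<and> q z = 0")
    case False
    with Suc.prems show ?thesis
      by - (rule exI[of _ "Suc m"], rule exI[of _ id], rule exI[of _ A], rule exI[of _ B], rule exI[of _ q],
        auto simp: linear_map_id[unfolded id_def])
  next
    case True
    then obtain z where z: "z \<in> Rn (Suc m)" "z \<noteq> origin" "A z = 0" "q z = 0" by auto
    obtain \<pi> A' B' q' where step: "linear_map (Suc m) m \<pi>" "\<pi> ` Rn (Suc m) = Rn m" "normal_jet m A' B' q'"
      "\<And>x. x \<in> Rn (Suc m) \<Longrightarrow> A x = A' (\<pi> x) \<and> B x = B' (\<pi> x) \<and> q x = q' (\<pi> x)"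
      using normal_jet_project_along[OF Suc.prems z] by blast
    \<comment> \<open>The bound \<open>k \<le> m\<close> is already strict relative to
      \<open>Suc m\<close>.\<close>
    obtain k \<rho> A'' B'' q'' where IH: "k \<le> m" "linear_map m k \<rho>" "\<rho> ` Rn m = Rn k" "normal_jet k A'' B'' q''"
      "\<forall>x\<in>Rn m. A' x = A'' (\<rho> x) \<and> B' x = B'' (\<rho> x) \<and> q' x = q'' (\<rho> x)"
      "\<forall>y\<in>Rn k - {origin}. A'' y = 0 \<longrightarrow> q'' y \<noteq> 0"
      using Suc.IH[OF step(3)] by blast
    have "(\<rho> \<circ> \<pi>) ` Rn (Suc m) = Rn k"
      using step(2) IH(3) by (simp only: image_comp[symmetric])
    moreover have "A x = A'' ((\<rho> \<circ> \<pi>) x) \<and> B x = B'' ((\<rho> \<circ> \<pi>) x) \<and> q x = q'' ((\<rho> \<circ> \<pi>) x)"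
      if "x \<in> Rn (Suc m)" for x
    proof -
      have "\<pi> x \<in> Rn m" using step(2) that by blast
      then show ?thesis using step(4)[OF that] IH(5) by simp
    qed
    ultimately show ?thesis
      using IH linear_map_comp[OF step(1) IH(2)]
      by - (rule exI[of _ k], rule exI[of _ "\<rho> \<circ> \<pi>"], rule exI[of _ A''], rule exI[of _ B''],
        rule exI[of _ q''], auto simp: comp_def)
  qed
qed

section \<open>Roundings and their normalised 2-jets\<close>

abbreviation jet_fraction ::
    "((nat \<Rightarrow> real) \<Rightarrow> 'b::real_vector) \<Rightarrow> ((nat \<Rightarrow> real) \<Rightarrow> 'b) \<Rightarrow> ((nat \<Rightarrow> real) \<Rightarrow> real) \<Rightarrow> (nat \<Rightarrow> real) \<Rightarrow> 'b"
  where "jet_fraction A B q \<equiv> (\<lambda>x. (A x + B x) /\<^sub>R (1 + q x))"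

lemma analytic_germ_2_jet_along_line:
  fixes \<Phi> :: "(nat \<Rightarrow> real) \<Rightarrow> 'b::euclidean_space"
  assumes \<Phi>: "analytic_germ m \<Phi>" "\<Phi> origin = 0" and v: "v \<in> Rn m"
  shows "((\<lambda>t. \<Phi> (\<lambda>i. t * v i) /\<^sub>R t) \<longlongrightarrow> taylor_part m 1 \<Phi> v) (at 0)"
    "((\<lambda>t. (\<Phi> (\<lambda>i. t * v i) - t *\<^sub>R taylor_part m 1 \<Phi> v) /\<^sub>R t\<^sup>2) \<longlongrightarrow> taylor_part m 2 \<Phi> v) (at 0)"
proof -
  obtain c where c: "power_series_at_origin m \<Phi> c"
    using \<Phi> by (auto simp: analytic_germ_def)
  note lim = power_series_remainder_tendsto[OF power_series_along_line[OF c v], folded taylor_part_eq[OF c]]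
  \<comment> \<open>At \<open>t = 0\<close> only the term with \<open>0 ^ 0 = 1\<close> survives, so
    the part of degree 0 equals \<open>\<Phi> origin\<close>.\<close>
  have "(\<lambda>d. 0 ^ d *\<^sub>R taylor_part m d \<Phi> v) sums \<Phi> (\<lambda>i. 0 * v i)"
    using eventually_nhds_x_imp_x[OF power_series_along_line[OF c v]] taylor_part_eq[OF c] by simp
  moreover have "(\<lambda>d. 0 ^ d *\<^sub>R taylor_part m d \<Phi> v) sums taylor_part m 0 \<Phi> v"
    using sums_single[of 0 "\<lambda>d. taylor_part m d \<Phi> v"]
    by (rule sums_cong[THEN iffD1, rotated]) (auto simp: power_0_left)
  ultimately have "taylor_part m 0 \<Phi> v = 0"
    using \<Phi>(2) sums_unique2 by fastforce
  then show "((\<lambda>t. \<Phi> (\<lambda>i. t * v i) /\<^sub>R t) \<longlongrightarrow> taylor_part m 1 \<Phi> v) (at 0)"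
    "((\<lambda>t. (\<Phi> (\<lambda>i. t * v i) - t *\<^sub>R taylor_part m 1 \<Phi> v) /\<^sub>R t\<^sup>2) \<longlongrightarrow> taylor_part m 2 \<Phi> v) (at 0)"
    using lim[of 1] lim[of 2] by (simp_all add: numeral_2_eq_2)
qed

lemma homogeneous_taylor_part:
  fixes \<Phi> :: "(nat \<Rightarrow> real) \<Rightarrow> 'b::euclidean_space"
  assumes "analytic_germ m \<Phi>"
  shows "homogeneous m d (taylor_part m d \<Phi>)"
  using assms taylor_part_eq by (force simp: analytic_germ_def homogeneous_def)

lemma quadratic_map_add:
  assumes "quadratic_map m f" "quadratic_map m g"
  shows "quadratic_map m (\<lambda>x. f x + g x)"
proof -
  obtain a b where "\<forall>x\<in>Rn m. f x = (\<Sum>d\<le>2. hom_poly m d a x)" "\<forall>x\<in>Rn m. g x = (\<Sum>d\<le>2. hom_poly m d b x)"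
    using assms by (auto simp: quadratic_map_def)
  then have "\<forall>x\<in>Rn m. f x + g x = (\<Sum>d\<le>2. hom_poly m d (\<lambda>\<alpha>. a \<alpha> + b \<alpha>) x)"
    by (simp add: hom_poly_def scaleR_add_right sum.distrib)
  then show ?thesis by (auto simp: quadratic_map_def)
qed

lemma quadratic_map_homogeneous:
  assumes "homogeneous m d f" "d \<le> 2"
  shows "quadratic_map m f"
proof -
  obtain c where c: "f = hom_poly m d c"
    using assms by (auto simp: homogeneous_def)
  \<comment> \<open>In \<open>quadratic_map\<close> one coefficient family serves all degrees up to
    2, so \<open>c\<close> is set to zero outside degree \<open>d\<close>.\<close>
  define c' where "c' \<alpha> = (if (\<Sum>i<m. \<alpha> i) = d then c \<alpha> else 0)" for \<alpha>
  have "hom_poly m e c' x = (if e = d then f x else 0)" for e x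
    unfolding c hom_poly_def c'_def by (auto intro!: sum.cong sum.neutral)
  then have "f x = (\<Sum>e\<le>2. hom_poly m e c' x)" for x
    using assms(2) by simp
  then show ?thesis by (auto simp: quadratic_map_def)
qed

text \<open>Removing the tangential part turns the degeneracy condition
  \<open>q z = (p z)\<^sup>2\<close> into a zero of the new form. The rank bound supplies the vector
  \<open>v\<close> on which the density arguments rest.\<close>

lemma degenerate_rounding_normal_jet:
  fixes \<Phi> :: "(nat \<Rightarrow> real) \<Rightarrow> 'b::euclidean_space"
  assumes "degenerate_rounding m \<Phi>"
  obtains p B q where "normal_jet m (taylor_part m 1 \<Phi>) B q"
    "\<And>x. B x = taylor_part m 2 \<Phi> x - p x *\<^sub>R taylor_part m 1 \<Phi> x"
    "\<exists>z\<in>Rn m - {origin}. taylor_part m 1 \<Phi> z = 0 \<and> q z = 0"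
    "\<exists>v\<in>Rn m. taylor_part m 1 \<Phi> v \<noteq> 0"
proof -
  define A B where "A = taylor_part m 1 \<Phi>" and "B = taylor_part m 2 \<Phi>"
  have \<Phi>: "rounding m \<Phi>" and "\<exists>p q. quotient_form m 1 (\<lambda>x. A x \<bullet> B x) (\<lambda>x. A x \<bullet> A x) p \<and>
      quotient_form m 2 (\<lambda>x. B x \<bullet> B x) (\<lambda>x. A x \<bullet> A x) q \<and>
      (\<exists>z\<in>Rn m - {origin}. A z = 0 \<and> q z = (p z)\<^sup>2)"
    using assms unfolding degenerate_rounding_def A_def B_def Let_def by blast+
  then obtain p q z where "quotient_form m 1 (\<lambda>x. A x \<bullet> B x) (\<lambda>x. A x \<bullet> A x) p"
      "quotient_form m 2 (\<lambda>x. B x \<bullet> B x) (\<lambda>x. A x \<bullet> A x) q"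
    and z: "z \<in> Rn m - {origin}" "A z = 0" "q z = (p z)\<^sup>2"
    by blast
  then have p: "homogeneous m 1 p" "\<And>x. x \<in> Rn m \<Longrightarrow> A x \<bullet> B x = p x * (A x \<bullet> A x)"
    and q: "homogeneous m 2 q" "\<And>x. x \<in> Rn m \<Longrightarrow> B x \<bullet> B x = q x * (A x \<bullet> A x)"
    by (simp_all only: quotient_form_def homogeneous_def)
  have AB: "homogeneous m 1 A" "homogeneous m 2 B"
    using \<Phi> by (auto simp: A_def B_def rounding_def intro: homogeneous_taylor_part)
  have "\<exists>v\<in>Rn m. A v \<noteq> 0"
  proof (rule ccontr)
    assume "\<not> ?thesis"
    then have "A ` Rn m \<subseteq> {0}" by auto
    then have "dim (A ` Rn m) = 0" by (simp only: dim_eq_0)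
    moreover have "dim (A ` Rn m) \<ge> 2" using \<Phi> unfolding rounding_def A_def by blast
    ultimately show False by linarith
  qed
  then obtain v where v: "v \<in> Rn m" "A v \<noteq> 0" by auto
  define B' q' where "B' x = B x - p x *\<^sub>R A x" and "q' x = q x - p x *\<^sub>R p x" for x
  have "homogeneous m (1 + 1) (\<lambda>x. p x *\<^sub>R A x)" "homogeneous m (1 + 1) (\<lambda>x. p x *\<^sub>R p x)"
    using p AB by (auto intro: homogeneous_mult simp only:)
  then have B': "homogeneous m 2 B'" and q': "homogeneous m 2 q'"
    unfolding B'_def q'_def one_add_one using AB q by (auto intro: homogeneous_diff)
  have orth: "A x \<bullet> B' x = 0" and norm: "B' x \<bullet> B' x = q' x * (A x \<bullet> A x)" if "x \<in> Rn m" for x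
    using p(2)[OF that] q(2)[OF that]
    by (simp_all add: B'_def q'_def inner_diff inner_commute[of "B x" "A x"] algebra_simps)
  \<comment> \<open>Where \<open>A\<close> is nonzero, \<open>q'\<close> is a quotient of squared
    norms; density covers the rest.\<close>
  have "q' x \<ge> 0" if "x \<in> Rn m" for x
  proof (rule homogeneous_nonneg_of_dense[OF AB(1) v q' _ that])
    fix x assume "x \<in> Rn m" "A x \<noteq> 0"
    then have "A x \<bullet> A x > 0" "q' x * (A x \<bullet> A x) \<ge> 0"
      using norm[of x, symmetric] by simp_all
    then show "q' x \<ge> 0"
      using mult_neg_pos[of "q' x" "A x \<bullet> A x"] by linarith
  qed
  then have "normal_jet m A B' q'"
    using AB(1) B' q' orth norm by (simp add: normal_jet_def)
  moreover have "q' z = 0" using z by (simp add: q'_def power2_eq_square)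
  moreover have "B' x = B x - p x *\<^sub>R A x" for x by (simp add: B'_def)
  ultimately show ?thesis
    using that[of B' q' p] z v unfolding A_def B_def by blast
qed

theorem proposition3p5:
  fixes m :: nat and \<Phi> :: "(nat \<Rightarrow> real) \<Rightarrow> real ^ 'n"
  assumes "degenerate_rounding m \<Phi>"
  shows "\<exists>k<m. \<exists>(\<pi> :: (nat \<Rightarrow> real) \<Rightarrow> (nat \<Rightarrow> real)) (\<Psi> :: (nat \<Rightarrow> real) \<Rightarrow> real ^ 'n).
    linear_map m k \<pi> \<and> \<pi> ` Rn m = Rn k \<and>
    fractional_quadratic_rounding k \<Psi> \<and> nondegenerate_rounding k \<Psi> \<and>
    equivalent_roundings m (\<Psi> \<circ> \<pi>) \<Phi>"
proof -
  let ?A = "taylor_part m 1 \<Phi>"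
  have \<Phi>: "rounding m \<Phi>" using assms by (simp add: degenerate_rounding_def)
  obtain p B q where jet: "normal_jet m ?A B q"
    and B: "\<And>x. B x = taylor_part m 2 \<Phi> x - p x *\<^sub>R ?A x"
    and ker: "\<exists>z\<in>Rn m - {origin}. ?A z = 0 \<and> q z = 0" and nz: "\<exists>v\<in>Rn m. ?A v \<noteq> 0"
    by (rule degenerate_rounding_normal_jet[OF assms]) (rule that)
  obtain k \<pi> A' B' q' where k: "k < m" and \<pi>: "linear_map m k \<pi>" "\<pi> ` Rn m = Rn k"
    and jet': "normal_jet k A' B' q'"
    and factor: "\<And>x. x \<in> Rn m \<Longrightarrow> ?A x = A' (\<pi> x) \<and> B x = B' (\<pi> x) \<and> q x = q' (\<pi> x)"
    and ker': "\<And>y. y \<in> Rn k - {origin} \<Longrightarrow> A' y = 0 \<Longrightarrow> q' y \<noteq> 0"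
    using normal_jet_reduce[OF jet] ker by blast
  define \<Psi> where "\<Psi> = jet_fraction A' B' q'"
  have hom: "homogeneous m 1 ?A" "homogeneous m 2 B" "homogeneous m 2 q"
    and orth: "\<And>x. x \<in> Rn m \<Longrightarrow> ?A x \<bullet> B x = 0"
    and norm: "\<And>x. x \<in> Rn m \<Longrightarrow> B x \<bullet> B x = q x * (?A x \<bullet> ?A x)"
    and pos: "\<And>x. x \<in> Rn m \<Longrightarrow> q x \<ge> 0"
    using jet by (simp_all only: normal_jet_def)
  have hom': "homogeneous k 1 A'" "homogeneous k 2 B'" "homogeneous k 2 q'"
    and orth': "\<And>x. x \<in> Rn k \<Longrightarrow> A' x \<bullet> B' x = 0"
    and norm': "\<And>x. x \<in> Rn k \<Longrightarrow> B' x \<bullet> B' x = q' x * (A' x \<bullet> A' x)"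
    and pos': "\<And>x. x \<in> Rn k \<Longrightarrow> q' x \<ge> 0"
    using jet' by (simp_all only: normal_jet_def)
  have \<Psi>\<pi>: "(\<Psi> \<circ> \<pi>) x = jet_fraction ?A B q x" if "x \<in> Rn m" for x
    using factor[OF that] by (simp add: \<Psi>_def)
  have scale_mem: "(\<lambda>i. t * v i) \<in> Rn m" if "v \<in> Rn m" for t v
    using that by (auto simp: topspace_Euclidean_space)
  have \<pi>_scale: "\<pi> (\<lambda>i. t * v i) = (\<lambda>i. t * \<pi> v i)" if "v \<in> Rn m" for t v
  proof -
    have "\<pi> (\<lambda>i. t * v i + 0 * v i) = (\<lambda>i. t * \<pi> v i + 0 * \<pi> v i)"
      using \<pi>(1) that unfolding linear_map_def by blast
    then show ?thesis by simp
  qed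
  have \<pi>_origin: "\<pi> origin = origin"
    using \<pi>_scale[of origin 0] by (simp add: topspace_Euclidean_space)

  \<comment> \<open>On \<open>Rn m\<close> the map \<open>\<Psi> \<circ> \<pi>\<close> is the
    quadratic fraction of the original normalised jet, so its series comes from the quotient lemma
    and no power series is composed.\<close>
  obtain c where c: "power_series_at_origin m (jet_fraction ?A B q) c" "hom_poly m 1 c = ?A"
    using power_series_quotient[OF hom pos] by blast
  have c\<Psi>: "power_series_at_origin m (\<Psi> \<circ> \<pi>) c"
    by (rule power_series_at_origin_cong[OF c(1)]) (simp only: \<Psi>\<pi>)
  obtain c' where c': "power_series_at_origin k \<Psi> c'" "hom_poly k 1 c' = A'" "hom_poly k 2 c' = B'"
    using power_series_quotient[OF hom' pos'] unfolding \<Psi>_def by blast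
  have taylor: "taylor_part m 1 (\<Psi> \<circ> \<pi>) = ?A" "taylor_part k 1 \<Psi> = A'" "taylor_part k 2 \<Psi> = B'"
    using taylor_part_eq[OF c\<Psi>] taylor_part_eq[OF c'(1)] c(2) c' by auto
  have origin: "\<Psi> origin = 0"
    using homogeneous_scale[OF hom'(1), of 0 origin] homogeneous_scale[OF hom'(2), of 0 origin]
    by (simp add: \<Psi>_def)

  have common_circle: "\<exists>C. circle C \<and>
      (\<forall>\<^sub>F t in nhds 0. (\<Psi> \<circ> \<pi>) (\<lambda>i. t * v i) \<in> C \<and> \<Phi> (\<lambda>i. t * v i) \<in> C)"
    if v: "v \<in> Rn m - {origin}" for v
  proof -
    have vm: "v \<in> Rn m" using v by simp
    obtain C where C: "circle C" "\<forall>\<^sub>F t in nhds 0. \<Phi> (\<lambda>i. t * v i) \<in> C"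
      using \<Phi> v by (auto simp: rounding_def)
    have \<Phi>0: "analytic_germ m \<Phi>" "\<Phi> origin = 0" using \<Phi> by (auto simp: rounding_def)
    have \<Psi>t: "(\<Psi> \<circ> \<pi>) (\<lambda>i. t * v i) = (t *\<^sub>R ?A v + t\<^sup>2 *\<^sub>R B v) /\<^sub>R (1 + t\<^sup>2 * q v)" for t
      using \<Psi>\<pi>[OF scale_mem[OF vm, of t]] homogeneous_scale[OF hom(1), of t v]
        homogeneous_scale[OF hom(2), of t v] homogeneous_scale[OF hom(3), of t v] by simp
    have "(t *\<^sub>R ?A v + t\<^sup>2 *\<^sub>R B v) /\<^sub>R (1 + t\<^sup>2 * q v) \<in> C" for t
    \<comment> \<open>If the linear part vanishes on \<open>v\<close>, so does \<open>B\<close>, and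
      the curve stays at the origin, which lies in \<open>C\<close>. Otherwise \<open>C\<close> is
      determined to second order, with \<open>p v\<close> as tangential coefficient.\<close>
    proof (cases "?A v = 0")
      case True
      then have "B v = 0" using norm[OF vm] by simp
      then show ?thesis using True eventually_nhds_x_imp_x[OF C(2)] \<Phi>0 by simp
    next
      case False
      show ?thesis
        by (rule circle_of_2_jet[OF C(1) C(2) _ analytic_germ_2_jet_along_line[OF \<Phi>0 vm] False B
              orth[OF vm] norm[OF vm] pos[OF vm]]) (simp add: \<Phi>0)
    qed
    then show ?thesis using C by (auto simp only: \<Psi>t simp_thms)
  qed
  have rank: "dim (?A ` Rn m) \<ge> 2" using \<Phi> by (simp add: rounding_def)
  have rounding_comp: "rounding m (\<Psi> \<circ> \<pi>)"
    unfolding rounding_def taylor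
  proof (intro conjI ballI rank)
    show "analytic_germ m (\<Psi> \<circ> \<pi>)" using c\<Psi> by (auto simp: analytic_germ_def)
    show "(\<Psi> \<circ> \<pi>) origin = 0" using origin \<pi>_origin by simp
    show "\<exists>C. circle C \<and> (\<forall>\<^sub>F t in nhds 0. (\<Psi> \<circ> \<pi>) (\<lambda>i. t * v i) \<in> C)"
      if "v \<in> Rn m - {origin}" for v
      using common_circle[OF that] by (auto elim: eventually_mono)
  qed
  have rounding_\<Psi>: "rounding k \<Psi>"
    unfolding rounding_def taylor
  proof (intro conjI ballI)
    show "analytic_germ k \<Psi>" using c' by (auto simp: analytic_germ_def)
    show "\<Psi> origin = 0" by (rule origin)
    \<comment> \<open>A line in \<open>Rn k\<close> lifts through the surjection
      \<open>\<pi>\<close> to a line in \<open>Rn m\<close>, where the circle is known.\<close>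
    show "\<exists>C. circle C \<and> (\<forall>\<^sub>F t in nhds 0. \<Psi> (\<lambda>i. t * w i) \<in> C)" if w: "w \<in> Rn k - {origin}" for w
    proof -
      obtain v where v: "v \<in> Rn m" "\<pi> v = w" using \<pi>(2) w by (metis DiffD1 imageE)
      then have "v \<noteq> origin" using w \<pi>_origin by auto
      then obtain C where "circle C" "\<forall>\<^sub>F t in nhds 0. (\<Psi> \<circ> \<pi>) (\<lambda>i. t * v i) \<in> C"
        using common_circle[of v] v by (auto simp: eventually_conj_iff)
      then show ?thesis using v \<pi>_scale[OF v(1)] by auto
    qed
    have "A' ` Rn k = ?A ` Rn m"
      using factor \<pi>(2) by (force simp: image_iff)
    then show "2 \<le> dim (A' ` Rn k)" using rank by simp
  qed
  have "fractional_quadratic_rounding k \<Psi>"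
    unfolding fractional_quadratic_rounding_def
  proof (intro conjI exI rounding_\<Psi>)
    show "quadratic_map k (\<lambda>x. A' x + B' x)" "quadratic_map k (\<lambda>x. 1 + q' x)"
      by (rule quadratic_map_add[OF quadratic_map_homogeneous quadratic_map_homogeneous],
          auto intro: hom' homogeneous_const simp del: One_nat_def)+
    show "1 + q' origin \<noteq> 0"
      using pos'[of origin] by (simp add: topspace_Euclidean_space)
    show "\<forall>\<^sub>F x in near_origin k. \<Psi> x = (A' x + B' x) /\<^sub>R (1 + q' x)"
      by (simp add: \<Psi>_def)
  qed
  moreover have "nondegenerate_rounding k \<Psi>"
    unfolding nondegenerate_rounding_def
  proof (intro conjI notI rounding_\<Psi>)
    \<comment> \<open>Degeneracy only provides some quotients \<open>r\<close> and \<open>s\<close>.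
      Where \<open>A'\<close> is nonzero they equal 0 and \<open>q'\<close>, hence everywhere by
      density, so \<open>y\<close> would be a common zero excluded by the reduction.\<close>
    assume "degenerate_rounding k \<Psi>"
    then obtain r s y where "quotient_form k 1 (\<lambda>x. A' x \<bullet> B' x) (\<lambda>x. A' x \<bullet> A' x) r"
        "quotient_form k 2 (\<lambda>x. B' x \<bullet> B' x) (\<lambda>x. A' x \<bullet> A' x) s"
      and y: "y \<in> Rn k - {origin}" "A' y = 0" "s y = (r y)\<^sup>2"
      unfolding degenerate_rounding_def taylor Let_def by blast
    then have r: "homogeneous k 1 r" "\<And>x. x \<in> Rn k \<Longrightarrow> A' x \<bullet> B' x = r x * (A' x \<bullet> A' x)"
      and s: "homogeneous k 2 s" "\<And>x. x \<in> Rn k \<Longrightarrow> B' x \<bullet> B' x = s x * (A' x \<bullet> A' x)"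
      by (simp_all only: quotient_form_def homogeneous_def)
    obtain v where v: "v \<in> Rn m" "?A v \<noteq> 0" using nz by auto
    have dense: "\<pi> v \<in> Rn k" "A' (\<pi> v) \<noteq> 0" using v factor[OF v(1)] \<pi>(2) by auto
    have yk: "y \<in> Rn k" using y by simp
    have "r y = 0"
    proof (rule homogeneous_eq_of_dense[OF hom'(1) dense r(1) homogeneous_zero _ yk])
      fix x assume "x \<in> Rn k" "A' x \<noteq> 0"
      then show "r x = 0" using r(2)[of x] orth'[of x] by simp
    qed
    moreover have "s y = q' y"
    proof (rule homogeneous_eq_of_dense[OF hom'(1) dense s(1) hom'(3) _ yk])
      fix x assume "x \<in> Rn k" "A' x \<noteq> 0"
      then show "s x = q' x" using s(2)[of x] norm'[of x] by simp
    qed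
    ultimately show False using ker'[OF y(1,2)] y(3) by simp
  qed
  moreover have "equivalent_roundings m (\<Psi> \<circ> \<pi>) \<Phi>"
    unfolding equivalent_roundings_def using rounding_comp \<Phi> common_circle by blast
  ultimately show ?thesis using k \<pi> by blast
qed

end
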